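(* Let $X$ and $Y$ be complex infinite-dimensional Banach spaces, $A\in B(X)$, $B\in B(Y)$, $C\in B(Y,X)$, and let $M_C=\begin{pmatrix}A&C\\0&B\end{pmatrix}\in B(X\oplus Y)$. Then $$\sigma_b(M_C)\cup\bigl(S(A^* )\cap S(B)\bigr)=\sigma_b(A)\cup\sigma_b(B).$$
   Context: $B(Y,X)$ is the set of bounded linear operators from $Y$ to $X$, and $B(X)=B(X,X)$. $A^*\in B(X^* )$ is the dual operator of $A$. For $T\in B(X)$ let $\alpha(T)=\dim N(T)$ and $\beta(T)=\dim X/R(T)$, where $N(T)$ and $R(T)$ are the kernel and range. The ascent $asc(T)$ is the smallest nonnegative integer $k$ with $N(T^k)=N(T^{k+1})$ ($\infty$ if none exists); the descent $des(T)$ is the smallest nonnegative integer $k$ with $R(T^k)=R(T^{k+1})$ ($\infty$ if none exists). $T$ is Fredholm if $\alpha(T)<\infty$ and $\beta(T)<\infty$; $T$ is a Browder operator if it is Fredholm and $asc(T)=des(T)<\infty$. The Browder spectrum is $\sigma_b(T)=\{\lambda\in\mathbb{C}: T-\lambda I\text{ is not a Browder operator}\}$. $T$ has the single valued extension property (SVEP) at $\lambda\in\mathbb{C}$ if there is $r>0$ such that for every open subset $V$ of the open disc $D(\lambda,r)$, the function $f\equiv 0$ is the only analytic solution of $(T-\mu)f(\mu)=0$ for all $\mu\in V$. $S(T)=\{\lambda\in\mathbb{C}: T\text{ fails to have the SVEP at }\lambda\}$. *)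

theory Defs
  imports "HOL-Analysis.Analysis" "HOL-Library.Extended_Nat"
begin

section \<open>Complex Banach spaces\<close>

class scaleC =
  fixes scaleC :: "complex \<Rightarrow> 'a \<Rightarrow> 'a"  (infixr "*\<^sub>C" 75)

text \<open>The existing real structure is required to be the restriction of the complex one, so that
  the real topological and differential library applies to complex spaces.\<close>

class complex_normed_vector = real_normed_vector + scaleC +
  assumes scaleC_add_right: "a *\<^sub>C (x + y) = a *\<^sub>C x + a *\<^sub>C y"
    and scaleC_add_left: "(a + b) *\<^sub>C x = a *\<^sub>C x + b *\<^sub>C x"
    and scaleC_scaleC: "a *\<^sub>C (b *\<^sub>C x) = (a * b) *\<^sub>C x"
    and scaleR_scaleC: "r *\<^sub>R x = complex_of_real r *\<^sub>C x"
    and norm_scaleC: "norm (a *\<^sub>C x) = cmod a * norm x"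

class complex_banach = complex_normed_vector + banach

lemma scaleC_one: "1 *\<^sub>C x = (x :: 'a::complex_normed_vector)"
  using scaleR_scaleC[of 1 x] by simp

global_interpretation complex_vector:
  vector_space "scaleC :: complex \<Rightarrow> 'a \<Rightarrow> 'a::complex_normed_vector"
  by unfold_locales
    (simp_all add: scaleC_add_right scaleC_add_left scaleC_scaleC scaleC_one)

instantiation complex :: complex_banach
begin

definition scaleC_complex :: "complex \<Rightarrow> complex \<Rightarrow> complex"
  where "scaleC_complex a z = a * z"

instance
  by standard (simp_all add: scaleC_complex_def algebra_simps norm_mult scaleR_conv_of_real)

end

text \<open>The direct sum of two spaces is their product type. The library norm on it is the
  Euclidean combination of the two norms.\<close>

instantiation prod :: (complex_normed_vector, complex_normed_vector) complex_normed_vector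
begin

definition scaleC_prod :: "complex \<Rightarrow> 'a \<times> 'b \<Rightarrow> 'a \<times> 'b"
  where "scaleC_prod c p = (c *\<^sub>C fst p, c *\<^sub>C snd p)"

instance
proof
  fix a b :: complex and x y :: "'a \<times> 'b" and r :: real
  show "a *\<^sub>C (x + y) = a *\<^sub>C x + a *\<^sub>C y"
    by (simp add: scaleC_prod_def scaleC_add_right)
  show "(a + b) *\<^sub>C x = a *\<^sub>C x + b *\<^sub>C x"
    by (simp add: scaleC_prod_def scaleC_add_left)
  show "a *\<^sub>C (b *\<^sub>C x) = (a * b) *\<^sub>C x"
    by (simp add: scaleC_prod_def scaleC_scaleC)
  show "r *\<^sub>R x = complex_of_real r *\<^sub>C x"
    by (simp add: scaleC_prod_def scaleR_prod_def scaleR_scaleC)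
  have "(norm (a *\<^sub>C x))\<^sup>2 = (cmod a * norm x)\<^sup>2"
    by (simp add: scaleC_prod_def norm_prod_def norm_scaleC power_mult_distrib distrib_left)
  then show "norm (a *\<^sub>C x) = cmod a * norm x"
    by (simp add: power2_eq_iff_nonneg)
qed

end

instance prod :: (complex_banach, complex_banach) complex_banach ..


section \<open>Bounded complex-linear operators\<close>

definition bounded_clinear ::
    "('a::complex_normed_vector \<Rightarrow> 'b::complex_normed_vector) \<Rightarrow> bool"
  where "bounded_clinear f \<longleftrightarrow> bounded_linear f \<and> (\<forall>c x. f (c *\<^sub>C x) = c *\<^sub>C f x)"

lemma bounded_clinearI:
  "bounded_linear f \<Longrightarrow> (\<And>c x. f (c *\<^sub>C x) = c *\<^sub>C f x) \<Longrightarrow> bounded_clinear f"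
  by (simp add: bounded_clinear_def)

lemma bounded_linear_scaleC_right:
  "bounded_linear (\<lambda>x. c *\<^sub>C (x :: 'a::complex_normed_vector))"
  by (rule bounded_linear_intro[where K = "cmod c"])
    (simp_all add: scaleC_add_right scaleR_scaleC scaleC_scaleC norm_scaleC mult.commute)

typedef (overloaded) ('a, 'b) cblinfun =
    "{f :: 'a::complex_normed_vector \<Rightarrow> 'b::complex_normed_vector. bounded_clinear f}"
  morphisms cblinfun_apply CBlinfun
  by (rule exI[of _ "\<lambda>_. 0"]) (simp add: bounded_clinear_def)

type_notation cblinfun  ("(_ \<Rightarrow>\<^sub>C\<^sub>L /_)" [22, 21] 21)
notation cblinfun_apply  (infixr "*\<^sub>V" 70)

setup_lifting type_definition_cblinfun

lemma bounded_clinear_apply: "bounded_clinear (cblinfun_apply T)"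
  using cblinfun_apply[of T] by simp

lemma bounded_linear_apply: "bounded_linear (cblinfun_apply T)"
  using bounded_clinear_apply[of T] by (simp add: bounded_clinear_def)

lemma cblinfun_apply_scaleC: "T *\<^sub>V (c *\<^sub>C x) = c *\<^sub>C (T *\<^sub>V x)"
  using bounded_clinear_apply[of T] by (simp add: bounded_clinear_def)

lemma cblinfun_eqI: "(\<And>x. S *\<^sub>V x = T *\<^sub>V x) \<Longrightarrow> S = T"
  by (metis cblinfun_apply_inject ext)

instantiation cblinfun :: (complex_normed_vector, complex_normed_vector) complex_normed_vector
begin

definition norm_cblinfun :: "('a \<Rightarrow>\<^sub>C\<^sub>L 'b) \<Rightarrow> real"
  where "norm_cblinfun T = onorm (cblinfun_apply T)"

lift_definition zero_cblinfun :: "'a \<Rightarrow>\<^sub>C\<^sub>L 'b" is "\<lambda>x. 0"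
  by (simp add: bounded_clinear_def)

lift_definition plus_cblinfun :: "('a \<Rightarrow>\<^sub>C\<^sub>L 'b) \<Rightarrow> ('a \<Rightarrow>\<^sub>C\<^sub>L 'b) \<Rightarrow> 'a \<Rightarrow>\<^sub>C\<^sub>L 'b"
  is "\<lambda>f g x. f x + g x"
  by (simp add: bounded_clinear_def bounded_linear_add scaleC_add_right)

lift_definition minus_cblinfun :: "('a \<Rightarrow>\<^sub>C\<^sub>L 'b) \<Rightarrow> ('a \<Rightarrow>\<^sub>C\<^sub>L 'b) \<Rightarrow> 'a \<Rightarrow>\<^sub>C\<^sub>L 'b"
  is "\<lambda>f g x. f x - g x"
  by (simp add: bounded_clinear_def bounded_linear_sub complex_vector.scale_right_diff_distrib)

lift_definition uminus_cblinfun :: "('a \<Rightarrow>\<^sub>C\<^sub>L 'b) \<Rightarrow> 'a \<Rightarrow>\<^sub>C\<^sub>L 'b" is "\<lambda>f x. - f x"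
  by (simp add: bounded_clinear_def bounded_linear_minus complex_vector.scale_minus_right)

lift_definition scaleR_cblinfun :: "real \<Rightarrow> ('a \<Rightarrow>\<^sub>C\<^sub>L 'b) \<Rightarrow> 'a \<Rightarrow>\<^sub>C\<^sub>L 'b"
  is "\<lambda>r f x. r *\<^sub>R f x"
  by (auto simp: bounded_clinear_def scaleR_scaleC scaleC_scaleC mult.commute
      intro: bounded_linear_compose[OF bounded_linear_scaleC_right])

lift_definition scaleC_cblinfun :: "complex \<Rightarrow> ('a \<Rightarrow>\<^sub>C\<^sub>L 'b) \<Rightarrow> 'a \<Rightarrow>\<^sub>C\<^sub>L 'b"
  is "\<lambda>c f x. c *\<^sub>C f x"
  by (auto simp: bounded_clinear_def scaleC_scaleC mult.commute
      intro: bounded_linear_compose[OF bounded_linear_scaleC_right])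

definition dist_cblinfun :: "('a \<Rightarrow>\<^sub>C\<^sub>L 'b) \<Rightarrow> ('a \<Rightarrow>\<^sub>C\<^sub>L 'b) \<Rightarrow> real"
  where "dist_cblinfun S T = norm (S - T)"

definition sgn_cblinfun :: "('a \<Rightarrow>\<^sub>C\<^sub>L 'b) \<Rightarrow> 'a \<Rightarrow>\<^sub>C\<^sub>L 'b"
  where "sgn_cblinfun T = inverse (norm T) *\<^sub>R T"

definition uniformity_cblinfun :: "(('a \<Rightarrow>\<^sub>C\<^sub>L 'b) \<times> ('a \<Rightarrow>\<^sub>C\<^sub>L 'b)) filter"
  where "uniformity_cblinfun = (INF e\<in>{0 <..}. principal {(S, T). dist S T < e})"

definition open_cblinfun :: "('a \<Rightarrow>\<^sub>C\<^sub>L 'b) set \<Rightarrow> bool"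
  where "open_cblinfun U \<longleftrightarrow> (\<forall>S\<in>U. \<forall>\<^sub>F (S', T) in uniformity. S' = S \<longrightarrow> T \<in> U)"

instance
proof
  fix S T U :: "'a \<Rightarrow>\<^sub>C\<^sub>L 'b" and a b :: complex and r s :: real
  show "S + T + U = S + (T + U)" by transfer (simp add: add.assoc)
  show "S + T = T + S" by transfer (simp add: add.commute)
  show "0 + S = S" by transfer simp
  show "- S + S = 0" by transfer simp
  show "S - T = S + - T" by transfer simp
  show "r *\<^sub>R (S + T) = r *\<^sub>R S + r *\<^sub>R T" by transfer (simp add: scaleR_add_right)
  show "(r + s) *\<^sub>R S = r *\<^sub>R S + s *\<^sub>R S" by transfer (simp add: scaleR_add_left)
  show "r *\<^sub>R (s *\<^sub>R S) = (r * s) *\<^sub>R S" by transfer simp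
  show "1 *\<^sub>R S = S" by transfer simp
  show "dist S T = norm (S - T)" by (rule dist_cblinfun_def)
  show "sgn S = inverse (norm S) *\<^sub>R S" by (rule sgn_cblinfun_def)
  show "(uniformity :: (('a \<Rightarrow>\<^sub>C\<^sub>L 'b) \<times> _) filter)
      = (INF e\<in>{0 <..}. principal {(S, T). dist S T < e})"
    by (rule uniformity_cblinfun_def)
  show "open V = (\<forall>S\<in>V. \<forall>\<^sub>F (S', T) in uniformity. S' = S \<longrightarrow> T \<in> V)"
    for V :: "('a \<Rightarrow>\<^sub>C\<^sub>L 'b) set"
    by (rule open_cblinfun_def)
  show "norm S = 0 \<longleftrightarrow> S = 0"
    using onorm_eq_0[OF bounded_linear_apply, of S]
    by (auto simp: norm_cblinfun_def zero_cblinfun.rep_eq intro: cblinfun_eqI)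
  show "norm (S + T) \<le> norm S + norm T"
    by (simp add: norm_cblinfun_def plus_cblinfun.rep_eq onorm_triangle bounded_linear_apply)
  show "norm (r *\<^sub>R S) = \<bar>r\<bar> * norm S"
    by (simp add: norm_cblinfun_def scaleR_cblinfun.rep_eq onorm_scaleR bounded_linear_apply)
  show "a *\<^sub>C (S + T) = a *\<^sub>C S + a *\<^sub>C T" by transfer (simp add: scaleC_add_right)
  show "(a + b) *\<^sub>C S = a *\<^sub>C S + b *\<^sub>C S" by transfer (simp add: scaleC_add_left)
  show "a *\<^sub>C (b *\<^sub>C S) = (a * b) *\<^sub>C S" by transfer (simp add: scaleC_scaleC)
  show "r *\<^sub>R S = complex_of_real r *\<^sub>C S" by transfer (simp add: scaleR_scaleC)
  have "onorm (\<lambda>x. a *\<^sub>C (S *\<^sub>V x)) = onorm (\<lambda>x. cmod a *\<^sub>R (S *\<^sub>V x))"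
    by (simp add: onorm_def norm_scaleC)
  then show "norm (a *\<^sub>C S) = cmod a * norm S"
    by (simp add: norm_cblinfun_def scaleC_cblinfun.rep_eq onorm_scaleR bounded_linear_apply)
qed

end

lemma norm_cblinfun_bound: "norm (T *\<^sub>V x) \<le> norm T * norm x"
  by (simp add: norm_cblinfun_def onorm bounded_linear_apply)

instance cblinfun :: (complex_normed_vector, complex_banach) complex_banach
proof
  fix X :: "nat \<Rightarrow> ('a \<Rightarrow>\<^sub>C\<^sub>L 'b)"
  assume X: "Cauchy X"
  define Y where "Y = (\<lambda>n. Blinfun (cblinfun_apply (X n)))"
  have Y_apply: "blinfun_apply (Y n) = cblinfun_apply (X n)" for n
    by (simp add: Y_def bounded_linear_Blinfun_apply bounded_linear_apply)
  have "norm (Y m - Y n) = norm (X m - X n)" for m n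
  proof -
    have "blinfun_apply (Y m - Y n) = cblinfun_apply (X m - X n)"
      by (auto simp: minus_blinfun.rep_eq minus_cblinfun.rep_eq Y_apply)
    then show ?thesis
      by (simp add: norm_blinfun_def norm_cblinfun_def)
  qed
  with X have "Cauchy Y"
    by (simp add: Cauchy_def dist_norm)
  then obtain L where L: "Y \<longlonglongrightarrow> L"
    using convergent_def Cauchy_convergent by blast
  have lim: "(\<lambda>n. X n *\<^sub>V x) \<longlonglongrightarrow> L x" for x
    using bounded_linear.tendsto[OF blinfun.bounded_linear_left[of x] L] by (simp add: Y_apply)
  have "L (c *\<^sub>C x) = c *\<^sub>C L x" for c x
  proof (rule LIMSEQ_unique[OF lim])
    show "(\<lambda>n. X n *\<^sub>V (c *\<^sub>C x)) \<longlonglongrightarrow> c *\<^sub>C L x"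
      using bounded_linear.tendsto[OF bounded_linear_scaleC_right lim]
      by (simp add: cblinfun_apply_scaleC)
  qed
  then have "bounded_clinear (blinfun_apply L)"
    by (intro bounded_clinearI blinfun.bounded_linear_right)
  then obtain T where T: "cblinfun_apply T = blinfun_apply L"
    using CBlinfun_inverse by blast
  have "norm (X n - T) = norm (Y n - L)" for n
  proof -
    have "blinfun_apply (Y n - L) = cblinfun_apply (X n - T)"
      by (auto simp: minus_blinfun.rep_eq minus_cblinfun.rep_eq Y_apply T)
    then show ?thesis
      by (simp add: norm_blinfun_def norm_cblinfun_def)
  qed
  with L have "X \<longlonglongrightarrow> T"
    by (simp add: LIMSEQ_def dist_norm)
  then show "convergent X"
    by (auto simp: convergent_def)
qed

lift_definition id_cblinfun :: "'a::complex_normed_vector \<Rightarrow>\<^sub>C\<^sub>L 'a" is "\<lambda>x. x"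
  by (simp add: bounded_clinear_def)

text \<open>The dual operator acts on the space of bounded complex-linear functionals. It is the Banach
  space transpose, not the Hilbert space adjoint, so no complex conjugation is involved.\<close>

lift_definition dual_op ::
    "('a::complex_normed_vector \<Rightarrow>\<^sub>C\<^sub>L 'b::complex_normed_vector)
      \<Rightarrow> ('b \<Rightarrow>\<^sub>C\<^sub>L complex) \<Rightarrow>\<^sub>C\<^sub>L ('a \<Rightarrow>\<^sub>C\<^sub>L complex)"
  is "\<lambda>T \<phi>. CBlinfun (\<lambda>x. \<phi> *\<^sub>V (T *\<^sub>V x))"
proof -
  fix T :: "'a \<Rightarrow>\<^sub>C\<^sub>L 'b"
  define D :: "('b \<Rightarrow>\<^sub>C\<^sub>L complex) \<Rightarrow> ('a \<Rightarrow>\<^sub>C\<^sub>L complex)"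
    where "D = (\<lambda>\<phi>. CBlinfun (\<lambda>x. \<phi> *\<^sub>V (T *\<^sub>V x)))"
  have D: "D \<phi> *\<^sub>V x = \<phi> *\<^sub>V (T *\<^sub>V x)" for \<phi> x
  proof -
    have "bounded_clinear (\<lambda>x. \<phi> *\<^sub>V (T *\<^sub>V x))"
      by (intro bounded_clinearI
          bounded_linear_compose[OF bounded_linear_apply bounded_linear_apply])
        (simp add: cblinfun_apply_scaleC)
    then show ?thesis
      by (simp add: D_def CBlinfun_inverse)
  qed
  have "norm (D \<phi>) \<le> norm \<phi> * norm T" for \<phi>
    unfolding norm_cblinfun_def[of "D \<phi>"]
  proof (rule onorm_bound)
    fix x
    have "norm (D \<phi> *\<^sub>V x) \<le> norm \<phi> * norm (T *\<^sub>V x)"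
      unfolding D by (rule norm_cblinfun_bound)
    also have "\<dots> \<le> norm \<phi> * (norm T * norm x)"
      by (intro mult_left_mono norm_cblinfun_bound norm_ge_zero)
    finally show "norm (D \<phi> *\<^sub>V x) \<le> norm \<phi> * norm T * norm x"
      by (simp add: mult.assoc)
  qed simp
  then have "bounded_linear D"
    by (intro bounded_linear_intro[where K = "norm T"])
      (auto intro!: cblinfun_eqI simp: D plus_cblinfun.rep_eq scaleR_cblinfun.rep_eq)
  then show "bounded_clinear
      (\<lambda>\<phi> :: 'b \<Rightarrow>\<^sub>C\<^sub>L complex. CBlinfun (\<lambda>x. \<phi> *\<^sub>V (T *\<^sub>V x)))"
    unfolding D_def[symmetric]
    by (rule bounded_clinearI) (auto intro!: cblinfun_eqI simp: D scaleC_cblinfun.rep_eq)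
qed

lemma dual_op_apply: "(dual_op T *\<^sub>V \<phi>) *\<^sub>V x = \<phi> *\<^sub>V (T *\<^sub>V x)"
proof -
  have "bounded_clinear (\<lambda>x. \<phi> *\<^sub>V (T *\<^sub>V x))"
    by (intro bounded_clinearI
        bounded_linear_compose[OF bounded_linear_apply bounded_linear_apply])
      (simp add: cblinfun_apply_scaleC)
  then show ?thesis
    by (simp add: dual_op.rep_eq CBlinfun_inverse)
qed

lift_definition upper_triangular_op ::
    "('a::complex_normed_vector \<Rightarrow>\<^sub>C\<^sub>L 'a) \<Rightarrow> ('b::complex_normed_vector \<Rightarrow>\<^sub>C\<^sub>L 'a)
      \<Rightarrow> ('b \<Rightarrow>\<^sub>C\<^sub>L 'b) \<Rightarrow> ('a \<times> 'b) \<Rightarrow>\<^sub>C\<^sub>L ('a \<times> 'b)"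
  is "\<lambda>A C B (x, y). (A x + C y, B y)"
  unfolding bounded_clinear_def case_prod_beta
  by (auto simp: scaleC_prod_def scaleC_add_right
      intro!: bounded_linear_Pair bounded_linear_add
        bounded_linear_compose[OF _ bounded_linear_fst]
        bounded_linear_compose[OF _ bounded_linear_snd])


section \<open>Fredholm and Browder operators\<close>

definition kernel :: "('a::complex_normed_vector \<Rightarrow> 'a) \<Rightarrow> 'a set"
  where "kernel f = {x. f x = 0}"

definition cdim :: "'a::complex_normed_vector set \<Rightarrow> enat"
  where "cdim V = (if \<exists>F. finite F \<and> complex_vector.span F = V
                   then enat (complex_vector.dim V) else \<infinity>)"

text \<open>The cosets \<open>b + W\<close>, \<open>b \<in> F\<close>, form a finite basis of the quotient of the whole space by the
  subspace \<open>W\<close>: every coset is a unique linear combination of them.\<close>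

definition quotient_basis :: "'a::complex_normed_vector set \<Rightarrow> 'a set \<Rightarrow> bool"
  where "quotient_basis W F \<longleftrightarrow> finite F \<and>
    (\<forall>x. \<exists>!c. (\<forall>b. b \<notin> F \<longrightarrow> c b = 0) \<and> x - (\<Sum>b\<in>F. c b *\<^sub>C b) \<in> W)"

definition quotient_cdim :: "'a::complex_normed_vector set \<Rightarrow> enat"
  where "quotient_cdim W = (if \<exists>F. quotient_basis W F
                            then enat (card (SOME F. quotient_basis W F)) else \<infinity>)"

definition nullity :: "('a::complex_normed_vector \<Rightarrow>\<^sub>C\<^sub>L 'a) \<Rightarrow> enat"
  where "nullity T = cdim (kernel (cblinfun_apply T))"

definition defect :: "('a::complex_normed_vector \<Rightarrow>\<^sub>C\<^sub>L 'a) \<Rightarrow> enat"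
  where "defect T = quotient_cdim (range (cblinfun_apply T))"

definition ascent :: "('a::complex_normed_vector \<Rightarrow>\<^sub>C\<^sub>L 'a) \<Rightarrow> enat"
  where "ascent T =
    (let stable = (\<lambda>k. kernel (cblinfun_apply T ^^ k) = kernel (cblinfun_apply T ^^ (k + 1)))
     in if \<exists>k. stable k then enat (LEAST k. stable k) else \<infinity>)"

definition descent :: "('a::complex_normed_vector \<Rightarrow>\<^sub>C\<^sub>L 'a) \<Rightarrow> enat"
  where "descent T =
    (let stable = (\<lambda>k. range (cblinfun_apply T ^^ k) = range (cblinfun_apply T ^^ (k + 1)))
     in if \<exists>k. stable k then enat (LEAST k. stable k) else \<infinity>)"

definition fredholm :: "('a::complex_normed_vector \<Rightarrow>\<^sub>C\<^sub>L 'a) \<Rightarrow> bool"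
  where "fredholm T \<longleftrightarrow> nullity T < \<infinity> \<and> defect T < \<infinity>"

definition browder :: "('a::complex_normed_vector \<Rightarrow>\<^sub>C\<^sub>L 'a) \<Rightarrow> bool"
  where "browder T \<longleftrightarrow> fredholm T \<and> ascent T = descent T \<and> ascent T < \<infinity>"

definition browder_spectrum :: "('a::complex_normed_vector \<Rightarrow>\<^sub>C\<^sub>L 'a) \<Rightarrow> complex set"
  where "browder_spectrum T = {z. \<not> browder (T - z *\<^sub>C id_cblinfun)}"


section \<open>The single valued extension property\<close>

text \<open>Complex differentiability in norm at every point; only used on open sets. The library's
  \<^const>\<open>analytic_on\<close> covers functions into the complex numbers only.\<close>

definition vector_analytic_on :: "(complex \<Rightarrow> 'a::complex_normed_vector) \<Rightarrow> complex set \<Rightarrow> bool"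
  where "vector_analytic_on f V \<longleftrightarrow>
    (\<forall>z\<in>V. \<exists>D. (f has_derivative (\<lambda>h. h *\<^sub>C D)) (at z))"

definition svep_at :: "('a::complex_normed_vector \<Rightarrow>\<^sub>C\<^sub>L 'a) \<Rightarrow> complex \<Rightarrow> bool"
  where "svep_at T z \<longleftrightarrow> (\<exists>r>0. \<forall>V. open V \<and> V \<subseteq> ball z r \<longrightarrow>
    (\<forall>f. vector_analytic_on f V \<and> (\<forall>\<mu>\<in>V. (T - \<mu> *\<^sub>C id_cblinfun) *\<^sub>V f \<mu> = 0)
      \<longrightarrow> (\<forall>\<mu>\<in>V. f \<mu> = 0)))"

definition svep_failure :: "('a::complex_normed_vector \<Rightarrow>\<^sub>C\<^sub>L 'a) \<Rightarrow> complex set"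
  where "svep_failure T = {z. \<not> svep_at T z}"

end

theory Submission
  imports Defs
begin

text \<open>
  Fix \<open>z\<close> and let \<open>R = A - z\<close>, \<open>S = B - z\<close>, and let \<open>M\<close> be the triangular operator with diagonal
  \<open>R, S\<close> and corner \<open>C\<close>. Taking complements, the theorem says that \<open>R\<close> and \<open>S\<close> are both Browder
  if and only if \<open>M\<close> is Browder and, in addition, the dual of \<open>A\<close> or \<open>B\<close> itself has the single
  valued extension property (SVEP) at \<open>z\<close>.

  An operator \<open>T\<close> is Browder exactly when, for some \<open>p > 0\<close>, the kernel of \<open>T\<^sup>p\<close> is
  finite-dimensional and the space is the direct sum of the kernel and the range of \<open>T\<^sup>p\<close>
  (\<open>browder_iff_fitting\<close>). In this form no index and no topology is left, and the first space being
  invariant under \<open>M\<close> makes it a diagram chase that any two of \<open>R\<close>, \<open>S\<close>, \<open>M\<close> being Browder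
  imply the third (\<open>fitting_upper_triangular\<close>, \<open>fitting_lower_corner\<close>, \<open>fitting_upper_corner\<close>).
  What needs analysis is the passage from \<open>M\<close> alone to one of the corners.

  If \<open>T\<close> is surjective on the range of \<open>T\<^sup>p\<close>, a nonzero vector of that range killed by \<open>T\<close> has a
  chain of preimages growing at most geometrically, and the power series with these coefficients is
  an analytic family of eigenvectors. So SVEP bounds the ascent by the descent
  (\<open>svep_at_ascent_le_descent\<close>). If \<open>M\<close> is Browder, then \<open>S\<close>, as a quotient of \<open>M\<close>, has finite
  descent, and SVEP of \<open>B\<close> gives \<open>S\<close> finite ascent, which is all that it lacks
  (\<open>fitting_lower_corner_of_ascent\<close>).

  The other case is dual. A Browder operator is bounded below on the range of its \<open>p\<close>-th power
  (\<open>fitting_bounded_below\<close>), and \<open>R\<close> inherits this estimate as a restriction of \<open>M\<close>. By the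
  Hahn--Banach theorem the estimate gives the dual operator finite descent; SVEP turns this into
  finite ascent of the dual operator; and a second use of Hahn--Banach translates finite ascent of
  the dual back into a statement on the ranges of \<open>R\<close> (\<open>range_sum_of_dual_svep\<close>).

  Conversely, if \<open>S\<close> is Browder, the same lower estimate shows that \<open>B\<close> has no eigenvalues in a
  punctured neighbourhood of \<open>z\<close>, and this gives \<open>B\<close> the SVEP at \<open>z\<close> (\<open>svep_at_of_fitting\<close>).
\<close>

section \<open>Finite-dimensional subspaces and quotients\<close>

text \<open>Containment in a finite span, rather than equality with one: this is monotone in \<open>V\<close> without
  \<open>V\<close> having to be a subspace.\<close>

definition fin_dim :: "'a::complex_normed_vector set \<Rightarrow> bool"
  where "fin_dim V \<longleftrightarrow> (\<exists>F. finite F \<and> V \<subseteq> complex_vector.span F)"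

lemma fin_dim_mono: "fin_dim W \<Longrightarrow> V \<subseteq> W \<Longrightarrow> fin_dim V"
  by (auto simp: fin_dim_def)

lemma fin_dim_obtain_generators:
  assumes "fin_dim V"
  obtains F where "finite F" "F \<subseteq> V" "V \<subseteq> complex_vector.span F"
proof -
  obtain B where B: "B \<subseteq> V" "complex_vector.independent B" "V \<subseteq> complex_vector.span B"
    using complex_vector.basis_exists[of V] by metis
  obtain F where "finite F" "V \<subseteq> complex_vector.span F"
    using assms by (auto simp: fin_dim_def)
  with B have "finite B"
    using complex_vector.independent_span_bound by blast
  with B that show thesis by blast
qed

lemma cdim_finite_iff_fin_dim:
  assumes "complex_vector.subspace V"
  shows "cdim V < \<infinity> \<longleftrightarrow> fin_dim V"
proof -
  have "(\<exists>F. finite F \<and> complex_vector.span F = V) \<longleftrightarrow> fin_dim V"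
    by (metis assms complex_vector.span_minimal fin_dim_def fin_dim_obtain_generators
        order_antisym order_refl)
  then show ?thesis by (simp add: cdim_def)
qed

lemma clinear_module_hom:
  fixes f :: "'a::complex_normed_vector \<Rightarrow> 'b::complex_normed_vector"
  assumes "bounded_clinear f"
  shows "module_hom scaleC scaleC f"
  using assms complex_vector.module_axioms[where 'a='a] complex_vector.module_axioms[where 'a='b]
  by (simp add: bounded_clinear_def module_hom_iff linear_add bounded_linear.linear)

lemma fin_dim_image:
  assumes "bounded_clinear f" "fin_dim V"
  shows "fin_dim (f ` V)"
proof -
  obtain F where "finite F" "V \<subseteq> complex_vector.span F"
    using assms by (auto simp: fin_dim_def)
  moreover have "f ` complex_vector.span F = complex_vector.span (f ` F)"
    using module_hom.span_image[OF clinear_module_hom[OF assms(1)]] by metis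
  ultimately show ?thesis
    unfolding fin_dim_def by (metis finite_imageI image_mono)
qed

text \<open>The finiteness half of the rank-nullity theorem: generators of the kernel together with
  preimages of generators of the image generate the space.\<close>

lemma fin_dim_extension:
  assumes f: "bounded_clinear f" and V: "complex_vector.subspace V"
    and image: "fin_dim (f ` V)" and ker: "fin_dim {x \<in> V. f x = 0}"
  shows "fin_dim V"
proof -
  interpret f: module_hom scaleC scaleC f by (rule clinear_module_hom[OF f])
  obtain B where B: "finite B" "B \<subseteq> f ` V" "f ` V \<subseteq> complex_vector.span B"
    using fin_dim_obtain_generators[OF image] by metis
  obtain G where G: "finite G" "{x \<in> V. f x = 0} \<subseteq> complex_vector.span G"
    using ker by (auto simp: fin_dim_def)
  have "\<forall>b\<in>B. \<exists>v. v \<in> V \<and> f v = b" using B(2) by blast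
  from bchoice[OF this] obtain g where g: "\<And>b. b \<in> B \<Longrightarrow> g b \<in> V \<and> f (g b) = b"
    by blast
  have "x \<in> complex_vector.span (G \<union> g ` B)" if x: "x \<in> V" for x
  proof -
    have "f x \<in> complex_vector.span B" using B(3) x by blast
    then obtain c where c: "f x = (\<Sum>b\<in>B. c b *\<^sub>C b)"
      using complex_vector.span_finite[OF B(1)] by auto
    define s where "s = (\<Sum>b\<in>B. c b *\<^sub>C g b)"
    have s: "s \<in> V" unfolding s_def
      by (intro complex_vector.subspace_sum[OF V] complex_vector.subspace_scale[OF V]) (use g in auto)
    have "f s = f x"
      unfolding s_def c f.sum f.scale by (rule sum.cong) (use g in auto)
    then have "x - s \<in> {x \<in> V. f x = 0}"
      using complex_vector.subspace_diff[OF V x s] by (simp add: f.diff)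
    then have "x - s \<in> complex_vector.span (G \<union> g ` B)"
      using G(2) complex_vector.span_mono[of G "G \<union> g ` B"] by blast
    moreover have "s \<in> complex_vector.span (G \<union> g ` B)" unfolding s_def
      by (intro complex_vector.span_sum complex_vector.span_scale complex_vector.span_base) auto
    ultimately show ?thesis
      using complex_vector.span_add by fastforce
  qed
  moreover have "finite (G \<union> g ` B)" using G(1) B(1) by simp
  ultimately show ?thesis
    unfolding fin_dim_def by (metis subsetI)
qed

text \<open>Among the finite families generating the space modulo \<open>W\<close>, one with the fewest elements is
  linearly independent modulo \<open>W\<close>, which is the uniqueness of coefficients.\<close>

lemma quotient_basis_exists:
  assumes W: "complex_vector.subspace W" and V: "fin_dim V"
    and sum: "\<And>x. \<exists>v\<in>V. x - v \<in> W"
  shows "\<exists>F. quotient_basis W F"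
proof -
  define Q where "Q F \<longleftrightarrow> finite F \<and> (\<forall>x. \<exists>c. x - (\<Sum>b\<in>F. c b *\<^sub>C b) \<in> W)" for F
  obtain F0 where F0: "finite F0" "V \<subseteq> complex_vector.span F0"
    using V by (auto simp: fin_dim_def)
  have "\<exists>c. x - (\<Sum>b\<in>F0. c b *\<^sub>C b) \<in> W" for x
  proof -
    obtain v where v: "v \<in> V" "x - v \<in> W" using sum by blast
    then obtain c where "v = (\<Sum>b\<in>F0. c b *\<^sub>C b)"
      using complex_vector.span_finite[OF F0(1)] F0(2) by auto
    with v show ?thesis by blast
  qed
  with F0 have "Q F0" by (simp add: Q_def)
  then obtain F where F: "Q F" and least: "\<And>G. Q G \<Longrightarrow> card F \<le> card G"
    using ex_has_least_nat[of Q F0 card] by blast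
  have fin: "finite F" using F by (simp add: Q_def)
  \<comment> \<open>A nontrivial relation modulo \<open>W\<close> would express one generator by the others.\<close>
  have indep: "\<forall>b\<in>F. d b = 0" if d: "(\<Sum>b\<in>F. d b *\<^sub>C b) \<in> W" for d
  proof (rule ccontr)
    assume "\<not> ?thesis"
    then obtain a where a: "a \<in> F" "d a \<noteq> 0" by blast
    have "\<exists>c. x - (\<Sum>b\<in>F - {a}. c b *\<^sub>C b) \<in> W" for x
    proof -
      obtain c where c: "x - (\<Sum>b\<in>F. c b *\<^sub>C b) \<in> W" using F by (auto simp: Q_def)
      define e where "e b = c b - (c a / d a) * d b" for b
      have "(\<Sum>b\<in>F. e b *\<^sub>C b) = (\<Sum>b\<in>F. c b *\<^sub>C b) - (c a / d a) *\<^sub>C (\<Sum>b\<in>F. d b *\<^sub>C b)"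
        by (simp add: e_def complex_vector.scale_left_diff_distrib sum_subtractf
            complex_vector.scale_sum_right scaleC_scaleC)
      then have eq: "x - (\<Sum>b\<in>F. e b *\<^sub>C b)
          = (x - (\<Sum>b\<in>F. c b *\<^sub>C b)) + (c a / d a) *\<^sub>C (\<Sum>b\<in>F. d b *\<^sub>C b)" by simp
      have "x - (\<Sum>b\<in>F. e b *\<^sub>C b) \<in> W"
        unfolding eq by (rule complex_vector.subspace_add[OF W c complex_vector.subspace_scale[OF W d]])
      moreover have "(\<Sum>b\<in>F. e b *\<^sub>C b) = (\<Sum>b\<in>F - {a}. e b *\<^sub>C b)"
        using sum.remove[OF fin a(1), of "\<lambda>b. e b *\<^sub>C b"] a by (simp add: e_def)
      ultimately show ?thesis by metis
    qed
    then have "Q (F - {a})" using fin by (simp add: Q_def)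
    then show False using least[of "F - {a}"] a fin card_Diff1_less[of F a] by simp
  qed
  have "\<exists>!c. (\<forall>b. b \<notin> F \<longrightarrow> c b = 0) \<and> x - (\<Sum>b\<in>F. c b *\<^sub>C b) \<in> W" for x
  proof (rule ex_ex1I)
    obtain c where c: "x - (\<Sum>b\<in>F. c b *\<^sub>C b) \<in> W" using F by (auto simp: Q_def)
    have "(\<Sum>b\<in>F. (if b \<in> F then c b else 0) *\<^sub>C b) = (\<Sum>b\<in>F. c b *\<^sub>C b)"
      by (rule sum.cong) auto
    with c show "\<exists>c. (\<forall>b. b \<notin> F \<longrightarrow> c b = 0) \<and> x - (\<Sum>b\<in>F. c b *\<^sub>C b) \<in> W"
      by (intro exI[of _ "\<lambda>b. if b \<in> F then c b else 0"]) auto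
  next
    fix c c'
    assume c: "(\<forall>b. b \<notin> F \<longrightarrow> c b = 0) \<and> x - (\<Sum>b\<in>F. c b *\<^sub>C b) \<in> W"
      and c': "(\<forall>b. b \<notin> F \<longrightarrow> c' b = 0) \<and> x - (\<Sum>b\<in>F. c' b *\<^sub>C b) \<in> W"
    have "(x - (\<Sum>b\<in>F. c' b *\<^sub>C b)) - (x - (\<Sum>b\<in>F. c b *\<^sub>C b)) \<in> W"
      using complex_vector.subspace_diff[OF W] c c' by blast
    moreover have "(x - (\<Sum>b\<in>F. c' b *\<^sub>C b)) - (x - (\<Sum>b\<in>F. c b *\<^sub>C b))
        = (\<Sum>b\<in>F. (c b - c' b) *\<^sub>C b)"
      by (simp add: complex_vector.scale_left_diff_distrib sum_subtractf)
    ultimately have "\<forall>b\<in>F. c b - c' b = 0"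
      using indep[of "\<lambda>b. c b - c' b"] by simp
    then show "c = c'" using c c' by (intro ext) (metis eq_iff_diff_eq_0)
  qed
  then have "quotient_basis W F" using fin by (simp add: quotient_basis_def)
  then show ?thesis ..
qed

section \<open>Kernels and ranges of operator powers\<close>

lemma bounded_clinear_funpow:
  fixes T :: "'a::complex_normed_vector \<Rightarrow>\<^sub>C\<^sub>L 'a"
  shows "bounded_clinear (cblinfun_apply T ^^ k)"
proof (induction k)
  case 0
  show ?case by (simp add: bounded_clinear_def bounded_linear_ident id_def)
next
  case (Suc k)
  then show ?case
    using bounded_linear_compose[OF bounded_linear_apply[of T]]
    by (auto simp: bounded_clinear_def o_def cblinfun_apply_scaleC)
qed

lemma bounded_linear_funpow:
  fixes T :: "'a::complex_normed_vector \<Rightarrow>\<^sub>C\<^sub>L 'a"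
  shows "bounded_linear (cblinfun_apply T ^^ k)"
  using bounded_clinear_funpow by (auto simp: bounded_clinear_def)

lemma funpow_linear_simps:
  fixes T :: "'a::complex_normed_vector \<Rightarrow>\<^sub>C\<^sub>L 'a"
  shows "(cblinfun_apply T ^^ k) (x + y) = (cblinfun_apply T ^^ k) x + (cblinfun_apply T ^^ k) y"
    and "(cblinfun_apply T ^^ k) (x - y) = (cblinfun_apply T ^^ k) x - (cblinfun_apply T ^^ k) y"
    and "(cblinfun_apply T ^^ k) 0 = 0"
    and "(cblinfun_apply T ^^ k) (c *\<^sub>C x) = c *\<^sub>C (cblinfun_apply T ^^ k) x"
  using bounded_clinear_funpow[of k T]
  by (auto simp: bounded_clinear_def bounded_linear.linear linear_add linear_diff linear_0)

lemma funpow_funpow: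
  fixes f :: "'a \<Rightarrow> 'a"
  shows "(f ^^ j) ((f ^^ k) x) = (f ^^ (j + k)) x"
  by (simp add: funpow_add)

lemma subspace_kernel_funpow:
  fixes T :: "'a::complex_normed_vector \<Rightarrow>\<^sub>C\<^sub>L 'a"
  shows "complex_vector.subspace (kernel (cblinfun_apply T ^^ k))"
  by (simp add: complex_vector.subspace_def kernel_def funpow_linear_simps)

lemma subspace_range_funpow:
  fixes T :: "'a::complex_normed_vector \<Rightarrow>\<^sub>C\<^sub>L 'a"
  shows "complex_vector.subspace (range (cblinfun_apply T ^^ k))"
  by (rule module_hom.subspace_image[OF clinear_module_hom[OF bounded_clinear_funpow]
        complex_vector.subspace_UNIV])

section \<open>Fitting decompositions and Browder operators\<close>

text \<open>The Fitting decomposition of the space into the kernel and the range of \<open>T\<^sup>p\<close>, with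
  finite-dimensional kernel. The conditions range over all exponents \<open>k\<close> instead of \<open>p\<close> alone,
  which makes them monotone in \<open>p\<close>, so that several operators can share one exponent.\<close>

definition fitting :: "('a::complex_normed_vector \<Rightarrow>\<^sub>C\<^sub>L 'a) \<Rightarrow> nat \<Rightarrow> bool"
  where "fitting T p \<longleftrightarrow> fin_dim (kernel (cblinfun_apply T ^^ p))
    \<and> (\<forall>k x. (cblinfun_apply T ^^ k) x = 0 \<longrightarrow> (cblinfun_apply T ^^ p) x = 0)
    \<and> (\<forall>k x. \<exists>n u. (cblinfun_apply T ^^ p) n = 0 \<and> x = n + (cblinfun_apply T ^^ k) u)"

lemma fitting_fin_dim: "fitting T p \<Longrightarrow> fin_dim (kernel (cblinfun_apply T ^^ p))"
  and fitting_kernel: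
    "fitting T p \<Longrightarrow> (cblinfun_apply T ^^ k) x = 0 \<Longrightarrow> (cblinfun_apply T ^^ p) x = 0"
  unfolding fitting_def by blast+

lemma fitting_sum:
  assumes "fitting T p"
  obtains n u where "(cblinfun_apply T ^^ p) n = 0" "x = n + (cblinfun_apply T ^^ k) u"
  using assms unfolding fitting_def by blast

lemma kernel_funpow_mono:
  fixes T :: "'a::complex_normed_vector \<Rightarrow>\<^sub>C\<^sub>L 'a"
  assumes "(cblinfun_apply T ^^ j) x = 0" "j \<le> k"
  shows "(cblinfun_apply T ^^ k) x = 0"
  using assms funpow_funpow[of "k - j" "cblinfun_apply T" j x] by (simp add: funpow_linear_simps)

lemma kernel_funpow_stable:
  fixes f :: "'a::zero \<Rightarrow> 'a"
  assumes step: "\<And>x. (f ^^ (p + 1)) x = 0 \<Longrightarrow> (f ^^ p) x = 0"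
    and "(f ^^ (p + k)) x = 0"
  shows "(f ^^ p) x = 0"
  using assms(2)
proof (induction k arbitrary: x)
  case (Suc k)
  have "(f ^^ (p + 1)) ((f ^^ k) x) = 0"
    using Suc.prems by (simp add: funpow_funpow add.commute)
  from step[OF this] show ?case
    using Suc.IH by (simp add: funpow_funpow)
qed simp

lemma range_funpow_stable:
  fixes f :: "'a \<Rightarrow> 'a"
  assumes "range (f ^^ p) = range (f ^^ (p + 1))"
  shows "\<exists>y. (f ^^ p) x = (f ^^ (p + k)) y"
proof (induction k arbitrary: x)
  case (Suc k)
  obtain y where y: "(f ^^ p) x = (f ^^ (p + k)) y" using Suc by blast
  obtain z where z: "(f ^^ p) y = (f ^^ (p + 1)) z"
    using assms by (metis imageE rangeI)
  have "(f ^^ (p + k)) y = (f ^^ k) ((f ^^ p) y)" by (simp add: funpow_funpow add.commute)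
  also have "\<dots> = (f ^^ (p + Suc k)) z"
    unfolding z funpow_funpow by (simp add: add.commute)
  finally show ?case using y by auto
qed auto

lemma fittingI:
  assumes fin: "fin_dim (kernel (cblinfun_apply T ^^ p))"
    and step: "\<And>x. (cblinfun_apply T ^^ (p + 1)) x = 0 \<Longrightarrow> (cblinfun_apply T ^^ p) x = 0"
    and sum: "\<And>k x. \<exists>n u. (cblinfun_apply T ^^ p) n = 0 \<and> x = n + (cblinfun_apply T ^^ k) u"
  shows "fitting T p"
  unfolding fitting_def
  using kernel_funpow_stable[OF step] kernel_funpow_mono[of _ T] assms
  by (metis le_add2)

lemma fitting_mono:
  assumes T: "fitting T p" and q: "p \<le> q"
  shows "fitting T q"
proof -
  have eq: "(cblinfun_apply T ^^ q) x = 0 \<longleftrightarrow> (cblinfun_apply T ^^ p) x = 0" for x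
    using T kernel_funpow_mono[OF _ q] unfolding fitting_def by blast
  then show ?thesis using T q unfolding fitting_def kernel_def by auto
qed

text \<open>On the kernel summand \<open>T\<close> is nilpotent and on the range summand it is bijective, so the chain of
  kernels and the chain of ranges both record when the nilpotent part vanishes. Hence ascent and
  descent agree.\<close>

lemma fitting_kernel_iff_range:
  assumes T: "fitting T p"
  shows "kernel (cblinfun_apply T ^^ k) = kernel (cblinfun_apply T ^^ (k + 1))
    \<longleftrightarrow> range (cblinfun_apply T ^^ k) = range (cblinfun_apply T ^^ (k + 1))"
    (is "?K \<longleftrightarrow> ?R")
proof
  let ?T = "cblinfun_apply T"
  assume K: ?K
  then have step: "(?T ^^ k) x = 0" if "(?T ^^ (k + 1)) x = 0" for x
    using that by (auto simp: kernel_def)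
  have "(?T ^^ k) x \<in> range (?T ^^ (k + 1))" for x
  proof -
    obtain n u where n: "(?T ^^ p) n = 0" "x = n + (?T ^^ 1) u"
      by (rule fitting_sum[OF T])
    have "(?T ^^ (k + p)) n = 0"
      using n(1) by (rule kernel_funpow_mono) simp
    then have "(?T ^^ k) n = 0" using kernel_funpow_stable[OF step] by blast
    then have "(?T ^^ k) x = (?T ^^ (k + 1)) u"
      using n(2) by (simp only: funpow_linear_simps funpow_funpow) simp
    then show ?thesis by blast
  qed
  moreover have "(?T ^^ (k + 1)) x \<in> range (?T ^^ k)" for x
    by (metis funpow_funpow rangeI)
  ultimately show ?R by blast
next
  let ?T = "cblinfun_apply T"
  assume R: ?R
  have "(?T ^^ k) x = 0" if x: "(?T ^^ (k + 1)) x = 0" for x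
  proof -
    obtain y where y: "(?T ^^ k) x = (?T ^^ (k + p)) y"
      using range_funpow_stable[OF R] by blast
    have "(?T ^^ (1 + (k + p))) y = 0"
      using x y by (simp add: funpow_funpow)
    then have "(?T ^^ p) y = 0" using fitting_kernel[OF T] by blast
    then show ?thesis using y kernel_funpow_mono[of p T y "k + p"] by simp
  qed
  moreover have "(?T ^^ (k + 1)) x = 0" if "(?T ^^ k) x = 0" for x
    using that by (rule kernel_funpow_mono) simp
  ultimately show ?K by (auto simp: kernel_def)
qed

text \<open>\<open>T\<close> maps the kernel of \<open>T\<^bsup>k + 1\<^esup>\<close> into that of \<open>T\<^sup>k\<close>, with fibres parallel to the kernel of
  \<open>T\<close>.\<close>

lemma fin_dim_kernel_funpow:
  assumes "fin_dim (kernel (cblinfun_apply T))"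
  shows "fin_dim (kernel (cblinfun_apply T ^^ k))"
proof (induction k)
  case 0
  then show ?case by (auto simp: kernel_def fin_dim_def intro!: exI[of _ "{}"])
next
  case (Suc k)
  show ?case
  proof (rule fin_dim_extension[OF bounded_clinear_apply[of T] subspace_kernel_funpow])
    show "fin_dim (cblinfun_apply T ` kernel (cblinfun_apply T ^^ Suc k))"
      using Suc by (rule fin_dim_mono) (auto simp: kernel_def funpow_swap1)
    show "fin_dim {x \<in> kernel (cblinfun_apply T ^^ Suc k). cblinfun_apply T x = 0}"
      using assms by (rule fin_dim_mono) (auto simp: kernel_def)
  qed
qed

text \<open>From left to right, finiteness of the nullity passes to the kernel of \<open>T\<^sup>p\<close> and the stable kernels
  and ranges give the two parts of the decomposition. From right to left, the defect is finite because
  the kernel summand generates the space modulo the range.\<close>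

theorem browder_iff_fitting: "browder T \<longleftrightarrow> (\<exists>p. fitting T p)"
proof
  let ?T = "cblinfun_apply T"
  assume T: "browder T"
  have "cdim (kernel (?T ^^ 1)) < \<infinity>"
    using T by (simp add: browder_def fredholm_def nullity_def)
  then have N: "fin_dim (kernel ?T)"
    using cdim_finite_iff_fin_dim[OF subspace_kernel_funpow[of 1 T]] by simp
  have "ascent T < \<infinity>" "descent T < \<infinity>" using T unfolding browder_def by metis+
  then obtain a d where a: "kernel (?T ^^ a) = kernel (?T ^^ (a + 1))"
    and d: "range (?T ^^ d) = range (?T ^^ (d + 1))"
    unfolding ascent_def descent_def Let_def by (auto split: if_splits)
  define p where "p = a + d + 1"
  have "fitting T p"
  proof (rule fittingI)
    show "fin_dim (kernel (?T ^^ p))" by (rule fin_dim_kernel_funpow[OF N])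
    have ker: "(?T ^^ a) x = 0" if "(?T ^^ k) x = 0" for k x
      using kernel_funpow_stable[of a ?T k x] a kernel_funpow_mono[OF that, of "a + k"]
      by (auto simp: kernel_def)
    show "(?T ^^ p) x = 0" if "(?T ^^ (p + 1)) x = 0" for x
      using ker[OF that] by (rule kernel_funpow_mono) (simp add: p_def)
    show "\<exists>n u. (?T ^^ p) n = 0 \<and> x = n + (?T ^^ k) u" for k x
    proof -
      obtain y where y: "(?T ^^ d) x = (?T ^^ (d + k)) y"
        using range_funpow_stable[OF d] by blast
      have "(?T ^^ d) (x - (?T ^^ k) y) = 0"
        by (simp add: funpow_linear_simps funpow_funpow y)
      then have "(?T ^^ p) (x - (?T ^^ k) y) = 0"
        by (rule kernel_funpow_mono) (simp add: p_def)
      moreover have "x = (x - (?T ^^ k) y) + (?T ^^ k) y" by simp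
      ultimately show ?thesis by blast
    qed
  qed
  then show "\<exists>p. fitting T p" ..
next
  let ?T = "cblinfun_apply T"
  assume "\<exists>p. fitting T p"
  then obtain p where T: "fitting T p" ..
  note stable = fitting_kernel_iff_range[OF T]
  have "kernel (?T ^^ p) = kernel (?T ^^ (p + 1))"
    using fitting_kernel[OF T, of "p + 1"] kernel_funpow_mono[of p T _ "p + 1"]
    unfolding kernel_def by (metis le_add1)
  then have ad: "ascent T = descent T" "ascent T < \<infinity>"
    unfolding ascent_def descent_def Let_def stable[symmetric] by auto
  have "fin_dim (kernel (?T ^^ 1))"
    by (rule fin_dim_mono[of "kernel (?T ^^ p)"])
      (use fitting_fin_dim[OF T] fitting_kernel[OF T, of 1] in \<open>auto simp: kernel_def\<close>)
  then have nul: "nullity T < \<infinity>"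
    using cdim_finite_iff_fin_dim[OF subspace_kernel_funpow[of 1 T]] by (simp add: nullity_def)
  have "\<exists>F. quotient_basis (range (?T ^^ 1)) F"
  proof (rule quotient_basis_exists[OF subspace_range_funpow])
    show "fin_dim (kernel (?T ^^ p))" by (rule fitting_fin_dim[OF T])
    fix x
    obtain n u where "(?T ^^ p) n = 0" "x = n + (?T ^^ 1) u"
      by (rule fitting_sum[OF T])
    then show "\<exists>v\<in>kernel (?T ^^ p). x - v \<in> range (?T ^^ 1)"
      by (intro bexI[of _ n]) (auto simp: kernel_def)
  qed
  then have "defect T < \<infinity>" by (simp add: defect_def quotient_cdim_def)
  with nul ad show "browder T" by (simp add: browder_def fredholm_def)
qed

section \<open>Triangular operators\<close>

text \<open>All that is used about powers of a triangular operator: the first space is invariant, \<open>A\<close> is the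
  restriction to it, and \<open>B\<close> is the operator induced on the quotient.\<close>

lemma upper_triangular_funpow:
  "(cblinfun_apply (upper_triangular_op A C B) ^^ k) (x, 0) = ((cblinfun_apply A ^^ k) x, 0)"
  "snd ((cblinfun_apply (upper_triangular_op A C B) ^^ k) e) = (cblinfun_apply B ^^ k) (snd e)"
proof -
  have 0: "B *\<^sub>V 0 = 0" "C *\<^sub>V 0 = 0"
    by (rule linear_0[OF bounded_linear.linear[OF bounded_linear_apply]])+
  show "(cblinfun_apply (upper_triangular_op A C B) ^^ k) (x, 0) = ((cblinfun_apply A ^^ k) x, 0)"
    by (induction k) (simp_all add: upper_triangular_op.rep_eq 0)
  show "snd ((cblinfun_apply (upper_triangular_op A C B) ^^ k) e) = (cblinfun_apply B ^^ k) (snd e)"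
    by (induction k) (simp_all add: upper_triangular_op.rep_eq case_prod_beta)
qed

lemma upper_triangular_funpow_eq_fst:
  assumes "(cblinfun_apply B ^^ k) (snd e) = 0"
  obtains a where "(cblinfun_apply (upper_triangular_op A C B) ^^ k) e = (a, 0)"
  using that assms upper_triangular_funpow(2)[of k A C B e] by (metis prod.collapse)

context
  fixes A :: "'a::complex_normed_vector \<Rightarrow>\<^sub>C\<^sub>L 'a"
    and B :: "'b::complex_normed_vector \<Rightarrow>\<^sub>C\<^sub>L 'b"
    and C :: "'b \<Rightarrow>\<^sub>C\<^sub>L 'a"
    and M :: "('a \<times> 'b) \<Rightarrow>\<^sub>C\<^sub>L ('a \<times> 'b)"
  defines "M \<equiv> upper_triangular_op A C B"
begin

private lemma M_simps:
  "(cblinfun_apply M ^^ k) (x, 0) = ((cblinfun_apply A ^^ k) x, 0)"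
  "snd ((cblinfun_apply M ^^ k) e) = (cblinfun_apply B ^^ k) (snd e)"
  by (simp_all add: M_def upper_triangular_funpow)

private lemma M_obtain:
  assumes "(cblinfun_apply B ^^ k) (snd e) = 0"
  obtains a where "(cblinfun_apply M ^^ k) e = (a, 0)"
  using upper_triangular_funpow_eq_fst[OF assms] M_def by metis

text \<open>The exponent doubles because a vector killed by a power of \<open>M\<close> is first moved into the first
  space by \<open>M\<^sup>p\<close>, since its second component is killed by \<open>B\<^sup>p\<close>, and only then killed by \<open>A\<^sup>p\<close>.
  For the decomposition, the second component is split by \<open>B\<close>, and then the image under \<open>M\<^sup>p\<close> of
  what remains is split by \<open>A\<close>.\<close>

lemma fitting_upper_triangular:
  assumes A: "fitting A p" and B: "fitting B p"
  shows "fitting M (2 * p)"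
  unfolding fitting_def
proof (intro conjI allI impI)
  let ?A = "cblinfun_apply A" and ?B = "cblinfun_apply B" and ?M = "cblinfun_apply M"
  show ker: "(?M ^^ (2 * p)) e = 0" if e: "(?M ^^ k) e = 0" for k e
  proof -
    have "(?B ^^ k) (snd e) = 0" using e M_simps(2)[of k e] by simp
    then have "(?B ^^ p) (snd e) = 0" using fitting_kernel[OF B] by blast
    then obtain a where a: "(?M ^^ p) e = (a, 0)" by (rule M_obtain)
    have "(?M ^^ k) (a, 0) = (?M ^^ p) ((?M ^^ k) e)"
      by (simp add: a[symmetric] funpow_funpow add.commute)
    then have "(?A ^^ k) a = 0" by (simp add: e M_simps funpow_linear_simps zero_prod_def)
    then have "(?A ^^ p) a = 0" using fitting_kernel[OF A] by blast
    then have "(?M ^^ p) ((?M ^^ p) e) = 0" by (simp add: a M_simps zero_prod_def)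
    then show ?thesis by (simp add: funpow_funpow mult_2)
  qed
  have snd: "bounded_clinear (snd :: 'a \<times> 'b \<Rightarrow> 'b)"
    by (intro bounded_clinearI bounded_linear_snd) (simp add: scaleC_prod_def)
  have emb: "bounded_clinear (\<lambda>x :: 'a. (x, 0 :: 'b))"
    by (intro bounded_clinearI bounded_linear_Pair bounded_linear_ident bounded_linear_zero)
      (simp add: scaleC_prod_def)
  show "fin_dim (kernel (?M ^^ (2 * p)))"
  proof (rule fin_dim_extension[OF snd subspace_kernel_funpow])
    have "snd ` kernel (?M ^^ (2 * p)) \<subseteq> kernel (?B ^^ (2 * p))"
      using M_simps(2)[of "2 * p"] by (auto simp: kernel_def) (metis snd_conv snd_zero)
    also have "\<dots> \<subseteq> kernel (?B ^^ p)" using fitting_kernel[OF B] by (auto simp: kernel_def)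
    finally show "fin_dim (snd ` kernel (?M ^^ (2 * p)))"
      by (rule fin_dim_mono[OF fitting_fin_dim[OF B]])
    have "{e \<in> kernel (?M ^^ (2 * p)). snd e = 0} \<subseteq> (\<lambda>x. (x, 0)) ` kernel (?A ^^ p)"
    proof clarify
      fix x :: 'a and y :: 'b
      assume *: "(x, y) \<in> kernel (?M ^^ (2 * p))" and "snd (x, y) = 0"
      then have y: "y = 0" by simp
      have "(?A ^^ (2 * p)) x = 0"
        using * unfolding y by (simp add: kernel_def M_simps zero_prod_def)
      then have "(?A ^^ p) x = 0" using fitting_kernel[OF A] by blast
      then show "(x, y) \<in> (\<lambda>x. (x, 0)) ` kernel (?A ^^ p)" by (simp add: y kernel_def)
    qed
    with fin_dim_image[OF emb fitting_fin_dim[OF A]]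
    show "fin_dim {e \<in> kernel (?M ^^ (2 * p)). snd e = 0}" by (rule fin_dim_mono)
  qed
  show "\<exists>n u. (?M ^^ (2 * p)) n = 0 \<and> e = n + (?M ^^ k) u" for k e
  proof -
    obtain n y where n: "(?B ^^ p) n = 0" "snd e = n + (?B ^^ k) y"
      by (rule fitting_sum[OF B])
    define e' where "e' = e - (?M ^^ k) (0, y)"
    have "snd e' = n" by (simp add: e'_def M_simps n(2))
    with n(1) obtain a where a: "(?M ^^ p) e' = (a, 0)" using M_obtain by metis
    obtain m b where m: "(?A ^^ p) m = 0" "a = m + (?A ^^ (p + k)) b"
      by (rule fitting_sum[OF A])
    have "(?M ^^ p) (e' - (?M ^^ k) (b, 0)) = (m, 0)"
      by (simp add: funpow_linear_simps a funpow_funpow M_simps m(2))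
    then have "(?M ^^ p) ((?M ^^ p) (e' - (?M ^^ k) (b, 0))) = 0"
      by (simp add: M_simps m(1) zero_prod_def)
    then have "(?M ^^ (2 * p)) (e' - (?M ^^ k) (b, 0)) = 0"
      by (simp add: funpow_funpow mult_2)
    moreover have "e = (e' - (?M ^^ k) (b, 0)) + (?M ^^ k) ((b, 0) + (0, y))"
      unfolding funpow_linear_simps e'_def by simp
    ultimately show ?thesis by blast
  qed
qed

text \<open>The kernel part is kept as the projection of a kernel vector of \<open>M\<close>; this later bounds the
  dimension of the kernel of \<open>B\<^sup>p\<close>.\<close>

lemma lower_corner_sum:
  assumes M: "fitting M p"
  obtains n u where "(cblinfun_apply M ^^ p) n = 0" and "(cblinfun_apply B ^^ p) (snd n) = 0"
    and "y = snd n + (cblinfun_apply B ^^ k) u"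
proof -
  obtain n u where n: "(cblinfun_apply M ^^ p) n = 0" "(0, y) = n + (cblinfun_apply M ^^ k) u"
    by (rule fitting_sum[OF M])
  have "(cblinfun_apply B ^^ p) (snd n) = 0" using n(1) M_simps(2)[of p n] by simp
  moreover have "y = snd n + (cblinfun_apply B ^^ k) (snd u)"
    using arg_cong[OF n(2), of snd] by (simp add: M_simps)
  ultimately show thesis by (rule that[OF n(1)])
qed

lemma range_lower_corner:
  assumes M: "fitting M p"
  shows "range (cblinfun_apply B ^^ p) = range (cblinfun_apply B ^^ (p + 1))"
proof
  let ?B = "cblinfun_apply B" and ?M = "cblinfun_apply M"
  have "(?B ^^ p) y \<in> range (?B ^^ (p + 1))" for y
  proof -
    obtain n u where "(?M ^^ p) n = 0" and n: "(?B ^^ p) (snd n) = 0" "y = snd n + (?B ^^ 1) u"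
      by (rule lower_corner_sum[OF M])
    have "(?B ^^ p) y = (?B ^^ (p + 1)) u"
      unfolding n(2) funpow_linear_simps funpow_funpow n(1) by simp
    then show ?thesis by blast
  qed
  then show "range (?B ^^ p) \<subseteq> range (?B ^^ (p + 1))" by blast
  show "range (?B ^^ (p + 1)) \<subseteq> range (?B ^^ p)"
    by (metis funpow_funpow image_subsetI rangeI)
qed

text \<open>A quotient of \<open>M\<close> inherits the spanning half of the decomposition. Once the kernels stabilise,
  the sum is direct, so that every vector in the kernel of \<open>B\<^sup>p\<close> is the second component of a vector in
  the finite-dimensional kernel of \<open>M\<^sup>p\<close>.\<close>

lemma fitting_lower_corner_of_ascent:
  assumes M: "fitting M p"
    and step: "\<And>y. (cblinfun_apply B ^^ (p + 1)) y = 0 \<Longrightarrow> (cblinfun_apply B ^^ p) y = 0"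
  shows "fitting B p"
proof (rule fittingI[OF _ step])
  let ?B = "cblinfun_apply B" and ?M = "cblinfun_apply M"
  show "\<exists>n u. (?B ^^ p) n = 0 \<and> y = n + (?B ^^ k) u" for k y
    using lower_corner_sum[OF M, of y k] by metis
  have "kernel (?B ^^ p) \<subseteq> snd ` kernel (?M ^^ p)"
  proof
    fix y assume "y \<in> kernel (?B ^^ p)"
    then have y: "(?B ^^ p) y = 0" by (simp add: kernel_def)
    obtain n u where n: "(?M ^^ p) n = 0" "(?B ^^ p) (snd n) = 0" "y = snd n + (?B ^^ p) u"
      by (rule lower_corner_sum[OF M])
    then have "(?B ^^ (p + p)) u = 0"
      using y by (simp add: funpow_linear_simps funpow_funpow)
    then have "(?B ^^ p) u = 0" using kernel_funpow_stable[OF step] by blast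
    with n show "y \<in> snd ` kernel (?M ^^ p)" by (auto simp: kernel_def)
  qed
  moreover have "bounded_clinear (snd :: 'a \<times> 'b \<Rightarrow> 'b)"
    by (intro bounded_clinearI bounded_linear_snd) (simp add: scaleC_prod_def)
  ultimately show "fin_dim (kernel (?B ^^ p))"
    by (metis fin_dim_image fin_dim_mono fitting_fin_dim[OF M])
qed

text \<open>A kernel vector \<open>y\<close> of a power of \<open>B\<close> lifts to \<open>(0, y)\<close>, which that power of \<open>M\<close> sends into the
  first space. Splitting the image by \<open>A\<close> and correcting the lift by the range part leaves a vector
  that \<open>M\<close> eventually kills, hence one that \<open>M\<^sup>p\<close> kills.\<close>

lemma fitting_lower_corner:
  assumes M: "fitting M p" and A: "fitting A p"
  shows "fitting B p"
proof (rule fitting_lower_corner_of_ascent[OF M])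
  let ?A = "cblinfun_apply A" and ?B = "cblinfun_apply B" and ?M = "cblinfun_apply M"
  fix y assume "(?B ^^ (p + 1)) y = 0"
  then obtain a where a: "(?M ^^ (p + 1)) (0, y) = (a, 0)"
    using M_obtain[of "p + 1" "(0, y)"] by auto
  obtain n b where n: "(?A ^^ p) n = 0" "a = n + (?A ^^ (p + 1)) b"
    by (rule fitting_sum[OF A])
  have "(?M ^^ (p + 1)) ((0, y) - (b, 0)) = (n, 0)"
    unfolding funpow_linear_simps a by (simp add: M_simps n(2) del: funpow.simps)
  then have "(?M ^^ p) ((?M ^^ (p + 1)) (- b, y)) = 0"
    by (simp add: M_simps n(1) zero_prod_def del: funpow.simps)
  then have "(?M ^^ p) (- b, y) = 0"
    unfolding funpow_funpow by (rule fitting_kernel[OF M])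
  then show "(?B ^^ p) y = 0" using M_simps(2)[of p "(- b, y)"] by simp
qed

lemma kernel_upper_corner:
  assumes M: "fitting M p"
  shows "fin_dim (kernel (cblinfun_apply A ^^ p))"
    and "(cblinfun_apply A ^^ k) x = 0 \<Longrightarrow> (cblinfun_apply A ^^ p) x = 0"
proof -
  let ?A = "cblinfun_apply A" and ?M = "cblinfun_apply M"
  have fst: "bounded_clinear (fst :: 'a \<times> 'b \<Rightarrow> 'a)"
    by (intro bounded_clinearI bounded_linear_fst) (simp add: scaleC_prod_def)
  have ker: "(?M ^^ k) (x, 0) = 0 \<longleftrightarrow> (?A ^^ k) x = 0" for k x
    by (simp add: M_simps zero_prod_def)
  then have "kernel (?A ^^ p) \<subseteq> fst ` kernel (?M ^^ p)" by (force simp: kernel_def)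
  with fin_dim_image[OF fst fitting_fin_dim[OF M]] show "fin_dim (kernel (?A ^^ p))"
    by (rule fin_dim_mono)
  show "(?A ^^ p) x = 0" if "(?A ^^ k) x = 0"
    using that unfolding ker[symmetric] by (rule fitting_kernel[OF M])
qed

text \<open>Splitting \<open>(x, 0)\<close> by \<open>M\<close> gives a splitting of \<open>x\<close>, because the second components of the two
  parts cancel and lie in complementary subspaces for \<open>B\<close>, hence vanish. The range part is taken with
  exponent \<open>k + p\<close>: \<open>M\<^sup>p\<close> moves its source into the first space and \<open>k\<close> further steps are those
  of \<open>A\<close>.\<close>

lemma fitting_upper_corner:
  assumes M: "fitting M p" and B: "fitting B p"
  shows "fitting A p"
  unfolding fitting_def
proof (intro conjI allI impI)
  let ?A = "cblinfun_apply A" and ?B = "cblinfun_apply B" and ?M = "cblinfun_apply M"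
  show "fin_dim (kernel (?A ^^ p))" using kernel_upper_corner(1)[OF M] .
  show "(?A ^^ p) x = 0" if "(?A ^^ k) x = 0" for k x
    using kernel_upper_corner(2)[OF M that] .
  show "\<exists>n u. (?A ^^ p) n = 0 \<and> x = n + (?A ^^ k) u" for k x
  proof -
    obtain n e where n: "(?M ^^ p) n = 0" "(x, 0) = n + (?M ^^ (k + p)) e"
      by (rule fitting_sum[OF M])
    have n2: "(?B ^^ p) (snd n) = 0" using n(1) M_simps(2)[of p n] by simp
    have sum: "snd n + (?B ^^ (k + p)) (snd e) = 0"
      using arg_cong[OF n(2), of snd] by (simp add: M_simps)
    then have "(?B ^^ p) (snd n) + (?B ^^ (p + (k + p))) (snd e) = 0"
      unfolding funpow_funpow[symmetric] funpow_linear_simps[symmetric]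
      by (simp only: funpow_linear_simps)
    then have e: "(?B ^^ p) (snd e) = 0"
      using fitting_kernel[OF B] n2 by (metis add_0)
    have "(?B ^^ (k + p)) (snd e) = 0" using e by (rule kernel_funpow_mono) simp
    with sum have "snd n = 0" by simp
    then obtain n1 where n1: "n = (n1, 0)" by (metis prod.collapse)
    obtain a where a: "(?M ^^ p) e = (a, 0)" using M_obtain[OF e] .
    have "(?M ^^ (k + p)) e = ((?A ^^ k) a, 0)"
      by (simp add: funpow_funpow[symmetric] a M_simps)
    then have "x = n1 + (?A ^^ k) a" using n(2) by (simp add: n1)
    moreover have "(?A ^^ p) n1 = 0" using n(1) by (simp add: n1 M_simps zero_prod_def)
    ultimately show ?thesis by blast
  qed
qed

end

section \<open>The open mapping principle for closed relations\<close>

text \<open>The open mapping theorem for a closed linear relation instead of an operator. It is used for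
  relations between vectors and their preimages under powers of operators, and then no closedness of
  any range has to be established. As for operators, the Baire category theorem gives approximate
  solutions of controlled norm and completeness sums up the successive corrections.\<close>

lemma closed_relation_bounded_selection:
  fixes Z :: "('a::banach \<times> 'b::banach) set"
  assumes Z: "closed Z" "subspace Z" and total: "\<And>u. \<exists>e. (u, e) \<in> Z"
  shows "\<exists>c>0. \<forall>u. \<exists>e. (u, e) \<in> Z \<and> norm e \<le> c * norm u"
proof -
  define D where "D n = {u. \<exists>e. (u, e) \<in> Z \<and> norm e \<le> real n}" for n :: nat
  have "\<exists>n. interior (closure (D n)) \<noteq> {}"
  proof (rule ccontr)
    assume "\<nexists>n. interior (closure (D n)) \<noteq> {}"
    then have empty: "interior (closure (D n)) = {}" for n by blast
    have "euclidean interior_of \<Union> (range (\<lambda>n. closure (D n))) = {}"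
    proof (rule Met_TC.metric_Baire_category_alt[unfolded mtopology_is_euclidean])
      show "Met_TC.mcomplete TYPE('a)" by (simp add: complete_UNIV)
      fix W assume "W \<in> range (\<lambda>n. closure (D n))"
      then show "closedin euclidean W \<and> euclidean interior_of W = {}"
        using empty by (elim imageE) simp
    qed simp
    then have "interior (\<Union> (range (\<lambda>n. closure (D n)))) = {}" by simp
    moreover have "u \<in> \<Union> (range (\<lambda>n. closure (D n)))" for u
    proof -
      obtain e where "(u, e) \<in> Z" using total by blast
      then have "u \<in> D (nat \<lceil>norm e\<rceil>)"
        unfolding D_def using of_nat_ceiling[of "norm e"] by blast
      then show ?thesis using closure_subset by blast
    qed
    ultimately show False
      by (metis UNIV_I UNIV_eq_I interior_UNIV empty_iff)
  qed
  then obtain n a where "a \<in> interior (closure (D n))" by blast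
  then obtain r where r: "0 < r" "ball a r \<subseteq> closure (D n)"
    using mem_interior by blast
  define K where "K = 4 * real n / r"
  \<comment> \<open>Every vector is solved up to half its norm, at a cost proportional to its norm.\<close>
  have approx: "\<exists>v e. (v, e) \<in> Z \<and> norm e \<le> K * norm u \<and> norm (u - v) \<le> norm u / 2" for u
  proof (cases "u = 0")
    case True
    then show ?thesis
      using subspace_0[OF Z(2)] by (intro exI[of _ 0]) (simp add: zero_prod_def)
  next
    case False
    \<comment> \<open>Rescaled to norm \<open>r / 2\<close>, the vector is the difference of two points of the ball around \<open>a\<close>,
      and hence nearly a difference of two elements of \<open>D n\<close>.\<close>
    define s where "s = 2 * norm u / r"
    have s: "s > 0" using False r by (simp add: s_def)
    define w where "w = (1 / s) *\<^sub>R u"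
    have "norm w = r / 2" using False r by (simp add: w_def s_def field_simps)
    then have "a + w \<in> closure (D n)" "a \<in> closure (D n)"
      using r by (auto simp: dist_norm subset_iff)
    then obtain b b' where b: "b \<in> D n" "dist b (a + w) < r / 8"
      and b': "b' \<in> D n" "dist b' a < r / 8"
      using r(1) unfolding closure_approachable by (metis divide_pos_pos zero_less_numeral)
    obtain e where e: "(b, e) \<in> Z" "norm e \<le> real n" using b by (auto simp: D_def)
    obtain e' where e': "(b', e') \<in> Z" "norm e' \<le> real n" using b' by (auto simp: D_def)
    have "s *\<^sub>R ((b, e) - (b', e')) \<in> Z"
      by (intro subspace_scale[OF Z(2)] subspace_diff[OF Z(2)] e e')
    then have 1: "(s *\<^sub>R (b - b'), s *\<^sub>R (e - e')) \<in> Z" by simp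
    have "norm (s *\<^sub>R (e - e')) \<le> s * (real n + real n)"
      using s norm_triangle_ineq4[of e e'] e(2) e'(2) by (simp add: mult_left_mono)
    also have "\<dots> = K * norm u" by (simp add: s_def K_def)
    finally have 2: "norm (s *\<^sub>R (e - e')) \<le> K * norm u" .
    have eq: "w - (b - b') = (b' - a) - (b - (a + w))" by simp
    have "norm (w - (b - b')) \<le> norm (b' - a) + norm (b - (a + w))"
      unfolding eq by (rule norm_triangle_ineq4)
    with b(2) b'(2) have "norm (w - (b - b')) \<le> r / 8 + r / 8" by (simp add: dist_norm)
    then have "s * norm (w - (b - b')) \<le> s * (r / 4)"
      using s by (simp add: mult_left_mono)
    moreover have "u - s *\<^sub>R (b - b') = s *\<^sub>R (w - (b - b'))"
      using s by (simp add: w_def scaleR_diff_right)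
    ultimately have "norm (u - s *\<^sub>R (b - b')) \<le> s * (r / 4)" using s by simp
    also have "\<dots> = norm u / 2" using r by (simp add: s_def)
    finally show ?thesis using 1 2 by blast
  qed
  then have "\<forall>u. \<exists>p. p \<in> Z \<and> norm (snd p) \<le> K * norm u \<and> norm (u - fst p) \<le> norm u / 2"
    by fastforce
  from choice[OF this] obtain g where g: "\<And>u. g u \<in> Z" "\<And>u. norm (snd (g u)) \<le> K * norm u"
    "\<And>u. norm (u - fst (g u)) \<le> norm u / 2" by blast
  have K: "0 \<le> K" using r by (simp add: K_def)
  have "\<exists>e. (u, e) \<in> Z \<and> norm e \<le> (2 * K + 1) * norm u" for u
  proof -
    \<comment> \<open>The error left after \<open>k\<close> corrections.\<close>
    define x where "x k = ((\<lambda>v. v - fst (g v)) ^^ k) u" for k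
    have x_le: "norm (x k) \<le> (1 / 2) ^ k * norm u" for k
    proof (induction k)
      case (Suc k)
      have "norm (x (Suc k)) \<le> norm (x k) / 2" using g(3)[of "x k"] by (simp add: x_def)
      with Suc show ?case by simp
    qed (simp add: x_def)
    have term_le: "norm (snd (g (x k))) \<le> (K * norm u) * (1 / 2) ^ k" for k
    proof -
      have "norm (snd (g (x k))) \<le> K * norm (x k)" by (rule g)
      also have "\<dots> \<le> K * ((1 / 2) ^ k * norm u)" by (rule mult_left_mono[OF x_le K])
      finally show ?thesis by (simp add: mult_ac)
    qed
    have geo: "(\<lambda>k. (K * norm u) * (1 / 2) ^ k) sums (K * norm u * 2)"
      using sums_mult[OF geometric_sums[of "1 / 2 :: real"], of "K * norm u"] by simp
    have sm: "summable (\<lambda>k. snd (g (x k)))"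
      by (rule summable_comparison_test'[OF sums_summable[OF geo]]) (rule term_le)
    have e_le: "norm (\<Sum>k. snd (g (x k))) \<le> K * norm u * 2"
      using norm_suminf_le[OF term_le sums_summable[OF geo]] sums_unique[OF geo] by simp
    have partial: "(\<Sum>k<N. fst (g (x k))) = u - x N" for N
      by (induction N) (simp_all add: x_def)
    have "x \<longlonglongrightarrow> 0"
    proof (rule Lim_null_comparison)
      show "\<forall>\<^sub>F k in sequentially. norm (x k) \<le> (1 / 2) ^ k * norm u"
        using x_le by simp
      show "(\<lambda>k. (1 / 2) ^ k * norm u) \<longlonglongrightarrow> 0"
        by (intro tendsto_mult_left_zero LIMSEQ_realpow_zero) auto
    qed
    then have "(\<lambda>N. u - x N) \<longlonglongrightarrow> u - 0" by (intro tendsto_intros)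
    then have "(\<lambda>N. (u - x N, \<Sum>k<N. snd (g (x k)))) \<longlonglongrightarrow> (u, \<Sum>k. snd (g (x k)))"
      using summable_LIMSEQ[OF sm] by (intro tendsto_Pair) auto
    moreover have "(u - x N, \<Sum>k<N. snd (g (x k))) \<in> Z" for N
    proof -
      have "(\<Sum>k<N. g (x k)) \<in> Z" by (intro subspace_sum[OF Z(2)] g)
      moreover have "(\<Sum>k<N. g (x k)) = (\<Sum>k<N. fst (g (x k)), \<Sum>k<N. snd (g (x k)))"
        by (simp add: prod_eq_iff fst_sum snd_sum)
      ultimately show ?thesis by (simp add: partial)
    qed
    ultimately have "(u, \<Sum>k. snd (g (x k))) \<in> Z"
      by (metis (no_types, lifting) closed_sequentially[OF Z(1)])
    moreover have "norm (\<Sum>k. snd (g (x k))) \<le> (2 * K + 1) * norm u"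
      using e_le by (simp add: algebra_simps add_increasing)
    ultimately show ?thesis by blast
  qed
  then show ?thesis using K by (intro exI[of _ "2 * K + 1"]) auto
qed

text \<open>The operator is bijective on the range of \<open>T\<^sup>p\<close>, and the estimate is the boundedness of its
  inverse there. To avoid working in a subspace, apply the selection principle to the relation between
  \<open>u\<close> and those \<open>e\<close> with \<open>u - T\<^bsup>p + 1\<^esup> e\<close> in the kernel of \<open>T\<^sup>p\<close>; for \<open>u = T\<^bsup>p + 1\<^esup> w\<close> directness of
  the sum forces \<open>T\<^sup>p e = T\<^sup>p w\<close>.\<close>

lemma fitting_bounded_below:
  fixes T :: "'a::complex_banach \<Rightarrow>\<^sub>C\<^sub>L 'a"
  assumes T: "fitting T p"
  shows "\<exists>c>0. \<forall>w. norm ((cblinfun_apply T ^^ p) w) \<le> c * norm ((cblinfun_apply T ^^ (p + 1)) w)"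
proof -
  define F where "F = cblinfun_apply T ^^ p"
  define G where "G = cblinfun_apply T ^^ (p + 1)"
  have F: "bounded_linear F" and G: "bounded_linear G"
    unfolding F_def G_def by (rule bounded_linear_funpow)+
  define Z where "Z = {v :: 'a \<times> 'a. F (fst v - G (snd v)) = 0}"
  have lin: "bounded_linear (\<lambda>v :: 'a \<times> 'a. F (fst v - G (snd v)))"
    by (intro bounded_linear_compose[OF F] bounded_linear_sub bounded_linear_fst
        bounded_linear_compose[OF G bounded_linear_snd])
  have cl: "closed Z" unfolding Z_def
    by (intro closed_Collect_eq linear_continuous_on[OF lin] continuous_on_const)
  have sub: "subspace Z" unfolding Z_def
    using linear_subspace_kernel[OF bounded_linear.linear[OF lin]] by simp
  have "\<exists>e. (u, e) \<in> Z" for u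
  proof -
    obtain n e where "F n = 0" "u = n + G e"
      unfolding F_def G_def by (rule fitting_sum[OF T])
    then have "(u, e) \<in> Z" by (simp add: Z_def)
    then show ?thesis ..
  qed
  from closed_relation_bounded_selection[OF cl sub this]
  obtain c where c: "0 < c" "\<And>u. \<exists>e. (u, e) \<in> Z \<and> norm e \<le> c * norm u" by blast
  obtain K where K: "0 < K" "\<And>x. norm (F x) \<le> norm x * K"
    using bounded_linear.pos_bounded[OF F] by blast
  have "norm (F w) \<le> (K * c) * norm (G w)" for w
  proof -
    obtain e where e: "(G w, e) \<in> Z" "norm e \<le> c * norm (G w)" using c by blast
    have "F (G (w - e)) = 0"
      using e(1) by (simp add: Z_def linear_diff[OF bounded_linear.linear[OF G]])
    then have "F (w - e) = 0"
      unfolding F_def G_def funpow_funpow by (rule fitting_kernel[OF T])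
    then have "F w = F e" by (simp add: linear_diff[OF bounded_linear.linear[OF F]])
    then have "norm (F w) \<le> norm e * K" using K(2)[of e] by simp
    also have "\<dots> \<le> (c * norm (G w)) * K" using e(2) K(1) by (simp add: mult_right_mono)
    finally show ?thesis by (simp add: mult_ac)
  qed
  moreover have "0 < K * c" using K c by simp
  ultimately show ?thesis unfolding F_def G_def by blast
qed

section \<open>The single valued extension property\<close>

lemma shift_apply: "(T - z *\<^sub>C id_cblinfun) *\<^sub>V x = T *\<^sub>V x - z *\<^sub>C x"
  by (simp add: minus_cblinfun.rep_eq scaleC_cblinfun.rep_eq id_cblinfun.rep_eq)

text \<open>An eigenvector for an eigenvalue \<open>\<mu>\<close> near but different from \<open>z\<close> would be multiplied by the small
  number \<open>\<mu> - z\<close> by an operator that is bounded below on the range containing it. So the analytic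
  solutions vanish off \<open>z\<close>, and at \<open>z\<close> by continuity.\<close>

lemma svep_at_of_fitting:
  fixes T :: "'a::complex_banach \<Rightarrow>\<^sub>C\<^sub>L 'a"
  assumes fit: "fitting (T - z *\<^sub>C id_cblinfun) p"
  shows "svep_at T z"
proof -
  let ?S = "cblinfun_apply (T - z *\<^sub>C id_cblinfun)"
  obtain c where c: "0 < c" "\<And>w. norm ((?S ^^ p) w) \<le> c * norm ((?S ^^ (p + 1)) w)"
    using fitting_bounded_below[OF fit] by blast
  have eigen: "w = 0"
    if w: "(T - \<mu> *\<^sub>C id_cblinfun) *\<^sub>V w = 0" and \<mu>: "\<mu> \<noteq> z" "\<mu> \<in> ball z (1 / c)" for \<mu> w
  proof (rule ccontr)
    assume "w \<noteq> 0"
    define d where "d = \<mu> - z"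
    have d: "d \<noteq> 0" "cmod d < 1 / c"
      using \<mu> by (auto simp: d_def dist_norm norm_minus_commute)
    have "?S w = d *\<^sub>C w"
      using w by (simp add: shift_apply d_def complex_vector.scale_left_diff_distrib)
    then have pow: "(?S ^^ k) w = d ^ k *\<^sub>C w" for k
      by (induction k) (simp_all add: cblinfun_apply_scaleC scaleC_scaleC scaleC_one mult.commute)
    have "cmod d ^ p * norm w \<le> c * (cmod d ^ (p + 1) * norm w)"
      using c(2)[of w] unfolding pow norm_scaleC norm_power .
    then have "cmod d ^ p * norm w * 1 \<le> cmod d ^ p * norm w * (c * cmod d)"
      by (simp add: mult_ac)
    moreover have "0 < cmod d ^ p * norm w" using d \<open>w \<noteq> 0\<close> by simp
    ultimately have "1 \<le> c * cmod d" using mult_le_cancel_left_pos by blast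
    then show False using d(2) c(1) by (simp add: field_simps)
  qed
  show ?thesis
    unfolding svep_at_def
  proof (intro exI[of _ "1 / c"] conjI allI impI ballI)
    show "0 < 1 / c" using c by simp
    fix V f \<mu>
    assume V: "open V \<and> V \<subseteq> ball z (1 / c)"
      and f: "vector_analytic_on f V \<and> (\<forall>\<mu>\<in>V. (T - \<mu> *\<^sub>C id_cblinfun) *\<^sub>V f \<mu> = 0)"
      and \<mu>: "\<mu> \<in> V"
    have zero: "f \<nu> = 0" if "\<nu> \<in> V" "\<nu> \<noteq> z" for \<nu> using eigen f V that by blast
    show "f \<mu> = 0"
    proof (cases "\<mu> = z")
      case True
      obtain D where "(f has_derivative (\<lambda>h. h *\<^sub>C D)) (at \<mu>)"
        using f \<mu> by (auto simp: vector_analytic_on_def)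
      then have "(f \<longlongrightarrow> f \<mu>) (at \<mu>)"
        using has_derivative_continuous continuous_within by blast
      moreover have "(f \<longlongrightarrow> 0) (at \<mu>)"
      proof (rule tendsto_eventually)
        show "\<forall>\<^sub>F \<nu> in at \<mu>. f \<nu> = 0"
          unfolding eventually_at_topological using V \<mu> zero True by blast
      qed
      ultimately show ?thesis using tendsto_unique[of "at \<mu>"] by auto
    qed (use zero \<mu> in blast)
  qed
qed

lemma power_series_at_center:
  fixes x :: "nat \<Rightarrow> 'a::complex_normed_vector"
  shows "(\<lambda>n. (z - z) ^ n *\<^sub>C x n) sums x 0"
proof -
  have "(\<lambda>n. (z - z) ^ n *\<^sub>C x n) = (\<lambda>n. if n = 0 then x n else 0)"
    by (simp add: fun_eq_iff power_0_left scaleC_one)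
  then show ?thesis using sums_single[of 0 x] by simp
qed

text \<open>On half the guaranteed radius of convergence the derived series is dominated by a multiple of
  \<open>n 2\<^sup>-\<^sup>n\<close>, so that termwise differentiation is justified.\<close>

lemma power_series_vector_analytic:
  fixes x :: "nat \<Rightarrow> 'a::complex_banach" and z :: complex
  assumes c: "0 < c" and x: "\<And>n. norm (x n) \<le> L * c ^ n"
  defines "V \<equiv> ball z (1 / (2 * c))"
  obtains f where "vector_analytic_on f V"
    and "\<And>\<mu>. \<mu> \<in> V \<Longrightarrow> (\<lambda>n. (\<mu> - z) ^ n *\<^sub>C x n) sums f \<mu>"
proof -
  have L: "0 \<le> L" using order_trans[OF norm_ge_zero x[of 0]] by simp
  have V: "cmod (\<mu> - z) \<le> 1 / (2 * c)" if "\<mu> \<in> V" for \<mu>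
    using that by (simp add: V_def dist_norm norm_minus_commute)
  define D where "D \<mu> = (\<Sum>n. (of_nat n * (\<mu> - z) ^ (n - 1)) *\<^sub>C x n)" for \<mu>
  define b where "b n = 2 * c * L * (real n * (1 / 2) ^ n)" for n
  have bound: "norm ((of_nat n * (\<mu> - z) ^ (n - 1)) *\<^sub>C x n) \<le> b n" if "\<mu> \<in> V" for n \<mu>
  proof (cases n)
    case (Suc m)
    have "norm ((of_nat n * (\<mu> - z) ^ (n - 1)) *\<^sub>C x n) = real n * cmod (\<mu> - z) ^ m * norm (x n)"
      by (simp add: norm_scaleC norm_mult norm_power Suc del: of_nat_Suc)
    also have "\<dots> \<le> real n * (1 / (2 * c)) ^ m * (L * c ^ n)"
      using c by (intro mult_mono mult_left_mono power_mono V that x) auto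
    also have "\<dots> = b n" using c by (simp add: b_def Suc power_divide field_simps)
    finally show ?thesis .
  qed (simp add: b_def)
  have "summable (\<lambda>n. real (Suc n) * (1 / 2 :: real) ^ n)"
    using geometric_deriv_sums[of "1 / 2 :: real"] by (simp add: sums_iff)
  then have "summable (\<lambda>n. real n * (1 / 2) ^ n)"
    by (rule summable_comparison_test') (simp add: mult_right_mono)
  then have "summable b" unfolding b_def by (rule summable_mult)
  from Weierstrass_m_test[OF bound this]
  have unif: "uniform_limit V (\<lambda>n \<mu>. \<Sum>i<n. (of_nat i * (\<mu> - z) ^ (i - 1)) *\<^sub>C x i) D sequentially"
    unfolding D_def .
  have "\<exists>f. \<forall>\<mu>\<in>V. (\<lambda>n. (\<mu> - z) ^ n *\<^sub>C x n) sums f \<mu>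
      \<and> (f has_derivative (\<lambda>h. h *\<^sub>C D \<mu>)) (at \<mu> within V)"
  proof (rule has_derivative_series)
    show "convex V" by (simp add: V_def)
    fix n \<mu>
    assume "\<mu> \<in> V"
    have "((\<lambda>\<mu>. (\<mu> - z) ^ n) has_field_derivative of_nat n * (\<mu> - z) ^ (n - 1)) (at \<mu> within V)"
      by (auto intro!: derivative_eq_intros)
    then have d: "((\<lambda>\<mu>. (\<mu> - z) ^ n) has_derivative (\<lambda>h. of_nat n * (\<mu> - z) ^ (n - 1) * h))
        (at \<mu> within V)" by (simp add: has_field_derivative_def)
    have "bounded_linear (\<lambda>a. a *\<^sub>C x n)"
      by (rule bounded_linear_intro[where K = "norm (x n)"])
        (simp_all add: scaleC_add_left scaleR_scaleC scaleC_scaleC norm_scaleC scaleC_complex_def)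
    from bounded_linear.has_derivative[OF this d]
    show "((\<lambda>\<mu>. (\<mu> - z) ^ n *\<^sub>C x n) has_derivative
        (\<lambda>h. h *\<^sub>C ((of_nat n * (\<mu> - z) ^ (n - 1)) *\<^sub>C x n))) (at \<mu> within V)"
      by (simp add: scaleC_scaleC mult.commute)
  next
    fix e :: real assume "0 < e"
    with unif have "\<forall>\<^sub>F n in sequentially. \<forall>\<mu>\<in>V.
        dist (\<Sum>i<n. (of_nat i * (\<mu> - z) ^ (i - 1)) *\<^sub>C x i) (D \<mu>) < e"
      by (simp add: uniform_limit_iff)
    then show "\<forall>\<^sub>F n in sequentially. \<forall>\<mu>\<in>V. \<forall>h.
        norm ((\<Sum>i<n. h *\<^sub>C ((of_nat i * (\<mu> - z) ^ (i - 1)) *\<^sub>C x i)) - h *\<^sub>C D \<mu>) \<le> e * norm h"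
    proof (rule eventually_mono, intro ballI allI)
      fix n \<mu> h
      assume *: "\<forall>\<mu>\<in>V. dist (\<Sum>i<n. (of_nat i * (\<mu> - z) ^ (i - 1)) *\<^sub>C x i) (D \<mu>) < e"
        and "\<mu> \<in> V"
      define s where "s = (\<Sum>i<n. (of_nat i * (\<mu> - z) ^ (i - 1)) *\<^sub>C x i)"
      have "norm (h *\<^sub>C s - h *\<^sub>C D \<mu>) = cmod h * norm (s - D \<mu>)"
        by (simp add: complex_vector.scale_right_diff_distrib[symmetric] norm_scaleC)
      also have "\<dots> \<le> cmod h * e"
        using * \<open>\<mu> \<in> V\<close> by (intro mult_left_mono) (auto simp: s_def dist_norm less_imp_le)
      finally show "norm ((\<Sum>i<n. h *\<^sub>C ((of_nat i * (\<mu> - z) ^ (i - 1)) *\<^sub>C x i)) - h *\<^sub>C D \<mu>)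
          \<le> e * norm h"
        by (simp add: s_def complex_vector.scale_sum_right mult.commute)
    qed
  next
    show "z \<in> V" using c by (simp add: V_def)
    show "(\<lambda>n. (z - z) ^ n *\<^sub>C x n) sums x 0" by (rule power_series_at_center)
  qed
  then obtain f where f: "\<And>\<mu>. \<mu> \<in> V \<Longrightarrow> (\<lambda>n. (\<mu> - z) ^ n *\<^sub>C x n) sums f \<mu>"
    "\<And>\<mu>. \<mu> \<in> V \<Longrightarrow> (f has_derivative (\<lambda>h. h *\<^sub>C D \<mu>)) (at \<mu> within V)" by blast
  have "vector_analytic_on f V"
    unfolding vector_analytic_on_def
    using f(2) at_within_open[of _ V] by (metis V_def open_ball)
  with f(1) that show thesis by blast
qed

text \<open>Let \<open>x\<^sub>0 = S\<^sup>p y\<close>, a vector killed by \<open>S\<close>. Because \<open>S\<close> maps the range of \<open>S\<^sup>p\<close> onto itself, there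
  is a chain of vectors \<open>x\<^sub>n\<close> in that range with \<open>S x\<^bsub>n + 1\<^esub> = x\<^sub>n\<close>, and the selection principle lets
  their norms grow at most geometrically. Then \<open>f \<mu> = (\<Sum>n. (\<mu> - z)\<^sup>n x\<^sub>n)\<close> satisfies
  \<open>S (f \<mu>) = (\<mu> - z) f \<mu>\<close>, so SVEP gives \<open>x\<^sub>0 = f z = 0\<close>. The chain is realised as \<open>x\<^sub>n = S\<^sup>p w\<^sub>n\<close> because
  the range of \<open>S\<^sup>p\<close> is not known to be complete, while the space of the \<open>w\<^sub>n\<close> is.\<close>

lemma svep_at_ascent_le_descent:
  fixes T :: "'a::complex_banach \<Rightarrow>\<^sub>C\<^sub>L 'a" and z :: complex
  defines "S \<equiv> T - z *\<^sub>C id_cblinfun"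
  assumes svep: "svep_at T z"
    and descent: "range (cblinfun_apply S ^^ p) = range (cblinfun_apply S ^^ (p + 1))"
    and kernel: "(cblinfun_apply S ^^ (p + 1)) y = 0"
  shows "(cblinfun_apply S ^^ p) y = 0"
proof -
  define F where "F = cblinfun_apply S ^^ p"
  define G where "G = cblinfun_apply S ^^ (p + 1)"
  have F: "bounded_linear F" and G: "bounded_linear G"
    unfolding F_def G_def by (rule bounded_linear_funpow)+
  have SF: "S *\<^sub>V F u = G u" for u by (simp add: F_def G_def)
  define Z where "Z = {v :: 'a \<times> 'a. G (snd v) - F (fst v) = 0}"
  have lin: "bounded_linear (\<lambda>v :: 'a \<times> 'a. G (snd v) - F (fst v))"
    by (intro bounded_linear_sub bounded_linear_compose[OF F bounded_linear_fst]
        bounded_linear_compose[OF G bounded_linear_snd])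
  have cl: "closed Z" unfolding Z_def
    by (intro closed_Collect_eq linear_continuous_on[OF lin] continuous_on_const)
  have sub: "subspace Z" unfolding Z_def
    using linear_subspace_kernel[OF bounded_linear.linear[OF lin]] by simp
  have "\<exists>e. (u, e) \<in> Z" for u
  proof -
    have "F u \<in> range G" using descent by (auto simp: F_def G_def)
    then obtain e where "F u = G e" by blast
    then have "(u, e) \<in> Z" by (simp add: Z_def)
    then show ?thesis ..
  qed
  from closed_relation_bounded_selection[OF cl sub this]
  obtain c where c: "0 < c" and "\<forall>u. \<exists>e. (u, e) \<in> Z \<and> norm e \<le> c * norm u" by blast
  from choice[OF this(2)] obtain g
    where g: "\<And>u. G (g u) = F u" "\<And>u. norm (g u) \<le> c * norm u"
    by (auto simp: Z_def)
  define w where "w n = (g ^^ n) y" for n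
  have w_le: "norm (w n) \<le> c ^ n * norm y" for n
  proof (induction n)
    case (Suc n)
    have "norm (w (Suc n)) \<le> c * norm (w n)" using g(2)[of "w n"] by (simp add: w_def)
    also have "\<dots> \<le> c * (c ^ n * norm y)" using Suc c by (simp add: mult_left_mono)
    finally show ?case by (simp add: mult_ac)
  qed (simp add: w_def)
  obtain K where K: "0 < K" "\<And>x. norm (F x) \<le> norm x * K"
    using bounded_linear.pos_bounded[OF F] by blast
  have x_le: "norm (F (w n)) \<le> (norm y * K) * c ^ n" for n
  proof -
    have "norm (F (w n)) \<le> norm (w n) * K" by (rule K)
    also have "\<dots> \<le> (c ^ n * norm y) * K" using w_le K by (simp add: mult_right_mono)
    finally show ?thesis by (simp add: mult_ac)
  qed
  have x_step: "S *\<^sub>V F (w (Suc n)) = F (w n)" for n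
    unfolding SF by (simp add: w_def g)
  have x_0: "S *\<^sub>V F (w 0) = 0" unfolding SF using kernel by (simp add: w_def G_def)
  obtain f where f: "vector_analytic_on f (ball z (1 / (2 * c)))"
    "\<And>\<mu>. \<mu> \<in> ball z (1 / (2 * c)) \<Longrightarrow> (\<lambda>n. (\<mu> - z) ^ n *\<^sub>C F (w n)) sums f \<mu>"
    using power_series_vector_analytic[OF c x_le] by blast
  have eq: "(T - \<mu> *\<^sub>C id_cblinfun) *\<^sub>V f \<mu> = 0" if \<mu>: "\<mu> \<in> ball z (1 / (2 * c))" for \<mu>
  proof -
    have "(\<lambda>n. S *\<^sub>V ((\<mu> - z) ^ n *\<^sub>C F (w n))) sums (S *\<^sub>V f \<mu>)"
      by (rule bounded_linear.sums[OF bounded_linear_apply f(2)[OF \<mu>]])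
    then have "(\<lambda>n. (\<mu> - z) ^ n *\<^sub>C (S *\<^sub>V F (w n))) sums (S *\<^sub>V f \<mu>)"
      by (simp add: cblinfun_apply_scaleC)
    then have "(\<lambda>n. (\<mu> - z) ^ Suc n *\<^sub>C (S *\<^sub>V F (w (Suc n)))) sums (S *\<^sub>V f \<mu>)"
      by (subst sums_Suc_iff) (simp add: x_0)
    then have "(\<lambda>n. (\<mu> - z) ^ Suc n *\<^sub>C F (w n)) sums (S *\<^sub>V f \<mu>)"
      unfolding x_step .
    moreover have "(\<lambda>n. (\<mu> - z) *\<^sub>C ((\<mu> - z) ^ n *\<^sub>C F (w n))) sums ((\<mu> - z) *\<^sub>C f \<mu>)"
      by (rule bounded_linear.sums[OF bounded_linear_scaleC_right f(2)[OF \<mu>]])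
    ultimately have "S *\<^sub>V f \<mu> = (\<mu> - z) *\<^sub>C f \<mu>"
      by (simp add: scaleC_scaleC sums_unique2)
    then show ?thesis
      by (simp add: S_def shift_apply complex_vector.scale_left_diff_distrib)
  qed
  obtain r where r: "0 < r" and unique: "\<forall>V. open V \<and> V \<subseteq> ball z r \<longrightarrow>
      (\<forall>f. vector_analytic_on f V \<and> (\<forall>\<mu>\<in>V. (T - \<mu> *\<^sub>C id_cblinfun) *\<^sub>V f \<mu> = 0)
        \<longrightarrow> (\<forall>\<mu>\<in>V. f \<mu> = 0))"
    using svep unfolding svep_at_def by (elim exE conjE)
  define V where "V = ball z (min r (1 / (2 * c)))"
  have V: "open V" "V \<subseteq> ball z r" "V \<subseteq> ball z (1 / (2 * c))" "z \<in> V"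
    using r c by (auto simp: V_def)
  have "vector_analytic_on f V" using f(1) V(3) by (auto simp: vector_analytic_on_def)
  moreover have "\<forall>\<mu>\<in>V. (T - \<mu> *\<^sub>C id_cblinfun) *\<^sub>V f \<mu> = 0" using eq V(3) by blast
  ultimately have "\<forall>\<mu>\<in>V. f \<mu> = 0"
    using unique[rule_format, OF conjI[OF V(1,2)] conjI] by blast
  then have "f z = 0" using V(4) by blast
  moreover have "(\<lambda>n. (z - z) ^ n *\<^sub>C F (w n)) sums f z"
    by (rule f(2)) (use V in blast)
  moreover have "(\<lambda>n. (z - z) ^ n *\<^sub>C F (w n)) sums F (w 0)"
    by (rule power_series_at_center[of z "\<lambda>n. F (w n)"])
  ultimately have "F (w 0) = 0" using sums_unique2 by metis
  then show ?thesis by (simp add: w_def F_def)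
qed

section \<open>The Hahn--Banach theorem\<close>

text \<open>The real theorem is proved by minimal sublinear functionals: a sublinear functional that is minimal
  among those below a given one is linear. Compared with extending a functional one dimension at a
  time, this avoids partial functions; the extension problem enters only through the choice of the
  majorant.\<close>

definition sublinear :: "('a::real_vector \<Rightarrow> real) \<Rightarrow> bool"
  where "sublinear q \<longleftrightarrow> (\<forall>x y. q (x + y) \<le> q x + q y) \<and> (\<forall>t x. 0 \<le> t \<longrightarrow> q (t *\<^sub>R x) = t * q x)"

lemma sublinearI:
  assumes "\<And>x y. q (x + y) \<le> q x + q y" and "q 0 = 0"
    and le: "\<And>t x. 0 < t \<Longrightarrow> q (t *\<^sub>R x) \<le> t * q x"
  shows "sublinear q"
proof -
  have "q (t *\<^sub>R x) = t * q x" if "0 \<le> t" for t x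
  proof (cases "t = 0")
    case False
    with that have t: "0 < t" by simp
    have "q ((1 / t) *\<^sub>R (t *\<^sub>R x)) \<le> (1 / t) * q (t *\<^sub>R x)" by (rule le) (use t in simp)
    then have "t * q x \<le> q (t *\<^sub>R x)" using t by (simp add: field_simps)
    with le[OF t, of x] show ?thesis by simp
  qed (use assms(2) in simp)
  with assms(1) show ?thesis by (simp add: sublinear_def)
qed

lemma sublinear_add: "sublinear q \<Longrightarrow> q (x + y) \<le> q x + q y"
  and sublinear_scale: "sublinear q \<Longrightarrow> 0 \<le> t \<Longrightarrow> q (t *\<^sub>R x) = t * q x"
  and sublinear_0: "sublinear q \<Longrightarrow> q 0 = 0"
  unfolding sublinear_def by (blast, blast, metis mult_zero_left order_refl scaleR_zero_left)

lemma sublinear_minus_le: "sublinear q \<Longrightarrow> - q (- x) \<le> q x"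
  using sublinear_add[of q x "- x"] sublinear_0[of q] by simp

text \<open>A common pattern for the three infima below: the one over a chain, the one along a direction, and
  the one over the subspace on which a functional is prescribed.\<close>

lemma sublinear_INF:
  fixes F :: "'i \<Rightarrow> 'a::real_vector \<Rightarrow> real"
  assumes ne: "I \<noteq> {}" and bdd: "\<And>x. bdd_below ((\<lambda>i. F i x) ` I)"
    and add: "\<And>i j x y. i \<in> I \<Longrightarrow> j \<in> I \<Longrightarrow> \<exists>k\<in>I. F k (x + y) \<le> F i x + F j y"
    and zero: "(INF i\<in>I. F i 0) = 0"
    and scale: "\<And>i t x. i \<in> I \<Longrightarrow> 0 < t \<Longrightarrow> \<exists>k\<in>I. F k (t *\<^sub>R x) \<le> t * F i x"
  shows "sublinear (\<lambda>x. INF i\<in>I. F i x)"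
proof (rule sublinearI)
  fix x y :: 'a
  have "(INF i\<in>I. F i (x + y)) - F j y \<le> (INF i\<in>I. F i x)" if j: "j \<in> I" for j
  proof (rule cINF_greatest[OF ne])
    fix i assume "i \<in> I"
    with add j obtain k where "k \<in> I" "F k (x + y) \<le> F i x + F j y" by blast
    then show "(INF i\<in>I. F i (x + y)) - F j y \<le> F i x"
      using cINF_lower[OF bdd, of k "x + y"] by simp
  qed
  then have "(INF i\<in>I. F i (x + y)) - (INF i\<in>I. F i x) \<le> (INF i\<in>I. F i y)"
    by (intro cINF_greatest[OF ne]) (simp add: algebra_simps)
  then show "(INF i\<in>I. F i (x + y)) \<le> (INF i\<in>I. F i x) + (INF i\<in>I. F i y)" by simp
next
  fix t :: real and x :: 'a assume t: "0 < t"
  have "(INF i\<in>I. F i (t *\<^sub>R x)) / t \<le> (INF i\<in>I. F i x)"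
  proof (rule cINF_greatest[OF ne])
    fix i assume "i \<in> I"
    with scale t obtain k where "k \<in> I" "F k (t *\<^sub>R x) \<le> t * F i x" by blast
    then show "(INF i\<in>I. F i (t *\<^sub>R x)) / t \<le> F i x"
      using cINF_lower[OF bdd, of k "t *\<^sub>R x"] t by (simp add: field_simps)
  qed
  then show "(INF i\<in>I. F i (t *\<^sub>R x)) \<le> t * (INF i\<in>I. F i x)"
    using t by (simp add: field_simps)
qed (rule zero)

text \<open>Lowering \<open>q\<close> as much as possible in the direction \<open>y\<close>. If \<open>q\<close> is minimal, nothing changes, and the
  last inequality becomes superadditivity.\<close>

lemma sublinear_directional_INF:
  fixes q :: "'a::real_vector \<Rightarrow> real" and y :: 'a
  assumes q: "sublinear q"
  defines "r \<equiv> \<lambda>x. INF t\<in>{0..}. q (x + t *\<^sub>R y) - t * q y"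
  shows "sublinear r" and "r x \<le> q x" and "r x \<le> q (x + y) - q y"
proof -
  have bdd: "bdd_below ((\<lambda>t. q (x + t *\<^sub>R y) - t * q y) ` {0..})" for x
  proof (rule bdd_belowI2)
    fix t :: real assume "t \<in> {0..}"
    then show "- q (- x) \<le> q (x + t *\<^sub>R y) - t * q y"
      using sublinear_add[OF q, of "x + t *\<^sub>R y" "- x"] sublinear_scale[OF q, of t y] by simp
  qed
  show "r x \<le> q x" unfolding r_def using cINF_lower[OF bdd, of 0 x] by simp
  show "r x \<le> q (x + y) - q y" unfolding r_def using cINF_lower[OF bdd, of 1 x] by simp
  show "sublinear r" unfolding r_def
  proof (rule sublinear_INF[OF _ bdd])
    fix s t :: real and x x' assume "s \<in> {0..}" "t \<in> {0..}"
    then show "\<exists>k\<in>{0..}. q (x + x' + k *\<^sub>R y) - k * q y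
        \<le> (q (x + s *\<^sub>R y) - s * q y) + (q (x' + t *\<^sub>R y) - t * q y)"
      using sublinear_add[OF q, of "x + s *\<^sub>R y" "x' + t *\<^sub>R y"]
      by (intro bexI[of _ "s + t"]) (simp_all add: algebra_simps)
  next
    show "(INF t\<in>{0..}. q (0 + t *\<^sub>R y) - t * q y) = 0"
      using sublinear_scale[OF q] by simp
  next
    fix t s :: real and x assume "t \<in> {0..}" "0 < s"
    then show "\<exists>k\<in>{0..}. q (s *\<^sub>R x + k *\<^sub>R y) - k * q y \<le> s * (q (x + t *\<^sub>R y) - t * q y)"
      using sublinear_scale[OF q, of s "x + t *\<^sub>R y"]
      by (intro bexI[of _ "s * t"]) (simp_all add: algebra_simps)
  qed simp
qed

lemma linear_below_sublinear:
  fixes p :: "'a::real_vector \<Rightarrow> real"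
  assumes p: "sublinear p"
  obtains f where "linear f" and "\<And>x. f x \<le> p x"
proof -
  define A where "A = {q. sublinear q \<and> q \<le> p}"
  have "\<exists>m\<in>A. \<forall>a\<in>A. a \<le> m \<longrightarrow> a = m"
  proof (rule predicate_Zorn)
    show "partial_order_on A (relation_of (\<lambda>m a. a \<le> m) A)"
      by (rule partial_order_on_relation_ofI) auto
    fix K assume K: "K \<in> Chains (relation_of (\<lambda>m a. a \<le> m) A)"
    have chain: "a \<in> A \<and> b \<in> A \<and> (a \<le> b \<or> b \<le> a)" if "a \<in> K" "b \<in> K" for a b
      using K that by (auto simp: Chains_def relation_of_def)
    show "\<exists>u\<in>A. \<forall>a\<in>K. u \<le> a"
    proof (cases "K = {}")
      case True
      then show ?thesis using p by (auto simp: A_def)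
    next
      case False
      have KA: "sublinear a" "a x \<le> p x" if "a \<in> K" for a x
        using chain[OF that that] by (auto simp: A_def le_fun_def)
      have bdd: "bdd_below ((\<lambda>a. a x) ` K)" for x
      proof (rule bdd_belowI2)
        fix a assume "a \<in> K"
        then show "- p (- x) \<le> a x" using KA(1)[of a] KA(2)[of a "- x"] sublinear_minus_le[of a x] by simp
      qed
      define u where "u x = (INF a\<in>K. a x)" for x
      have "sublinear u" unfolding u_def
      proof (rule sublinear_INF[OF False bdd])
        fix a b x y assume ab: "a \<in> K" "b \<in> K"
        then consider "a \<le> b" | "b \<le> a" using chain by blast
        then show "\<exists>k\<in>K. k (x + y) \<le> a x + b y"
        proof cases
          case 1
          then have "a y \<le> b y" by (simp add: le_fun_def)
          with sublinear_add[OF KA(1)[OF ab(1)], of x y] ab show ?thesis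
            by (intro bexI[of _ a]) auto
        next
          case 2
          then have "b x \<le> a x" by (simp add: le_fun_def)
          with sublinear_add[OF KA(1)[OF ab(2)], of x y] ab show ?thesis
            by (intro bexI[of _ b]) auto
        qed
      next
        show "(INF a\<in>K. a 0) = 0" using KA(1) False by (simp add: sublinear_0 cong: INF_cong_simp)
      next
        fix a t x assume "a \<in> K" "(0::real) < t"
        then show "\<exists>k\<in>K. k (t *\<^sub>R x) \<le> t * a x"
          using KA(1)[of a] sublinear_scale[of a t x] by (intro bexI[of _ a]) auto
      qed
      moreover have le: "u \<le> a" if "a \<in> K" for a
        unfolding le_fun_def u_def using cINF_lower[OF bdd that] by blast
      moreover have "u \<le> p"
      proof -
        obtain a where "a \<in> K" using False by blast
        then show ?thesis using le[of a] KA(2)[of a] by (meson le_funI order_trans le_funD)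
      qed
      ultimately show ?thesis unfolding A_def by blast
    qed
  qed
  then obtain m where m: "sublinear m" "m \<le> p"
    and minimal: "\<And>a. sublinear a \<Longrightarrow> a \<le> p \<Longrightarrow> a \<le> m \<Longrightarrow> a = m"
    by (auto simp: A_def)
  have add: "m (x + y) = m x + m y" for x y
  proof -
    define r where "r x = (INF t\<in>{0..}. m (x + t *\<^sub>R y) - t * m y)" for x
    have r: "sublinear r" "r \<le> m" "r x \<le> m (x + y) - m y"
      unfolding r_def le_fun_def using sublinear_directional_INF[OF m(1)] by auto
    have "r = m" by (rule minimal[OF r(1) _ r(2)]) (use r(2) m(2) in order)
    with r(3) sublinear_add[OF m(1), of x y] show ?thesis by simp
  qed
  have minus: "m (- x) = - m x" for x using add[of x "- x"] sublinear_0[OF m(1)] by simp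
  have "m (t *\<^sub>R x) = t *\<^sub>R m x" for t x
  proof (cases "0 \<le> t")
    case False
    then have "m ((- t) *\<^sub>R x) = - t * m x" by (intro sublinear_scale[OF m(1)]) simp
    then show ?thesis using minus[of "t *\<^sub>R x"] by simp
  qed (use sublinear_scale[OF m(1)] in simp)
  with add have "linear m" by (rule linearI)
  with m(2) that show thesis by (auto simp: le_fun_def)
qed

text \<open>Apply the preceding lemma to the largest sublinear functional that lies below \<open>c\<close> times the norm
  and below \<open>g\<close> on \<open>Z\<close>. A linear functional below \<open>g\<close> on a subspace equals \<open>g\<close> there, as seen at
  \<open>x\<close> and \<open>- x\<close>.\<close>

lemma real_extension:
  fixes g :: "'a::real_normed_vector \<Rightarrow> real"
  assumes Z: "subspace Z" and add: "\<And>x y. x \<in> Z \<Longrightarrow> y \<in> Z \<Longrightarrow> g (x + y) = g x + g y"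
    and scale: "\<And>t x. x \<in> Z \<Longrightarrow> g (t *\<^sub>R x) = t * g x"
    and bound: "\<And>x. x \<in> Z \<Longrightarrow> \<bar>g x\<bar> \<le> c * norm x" and c: "0 \<le> c"
  obtains f where "linear f" and "\<And>x. x \<in> Z \<Longrightarrow> f x = g x" and "\<And>x. \<bar>f x\<bar> \<le> c * norm x"
proof -
  define p where "p x = (INF z\<in>Z. c * norm (x - z) + g z)" for x
  have Z0: "0 \<in> Z" by (rule subspace_0[OF Z])
  have g0: "g 0 = 0" using scale[OF Z0, of 0] by simp
  have below: "- (c * norm x) \<le> c * norm (x - z) + g z" if "z \<in> Z" for x z
  proof -
    have "c * norm z \<le> c * (norm x + norm (x - z))"
      by (rule mult_left_mono[OF _ c]) (metis norm_minus_commute norm_triangle_sub)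
    then show ?thesis using bound[OF that] by (simp add: distrib_left)
  qed
  have bdd: "bdd_below ((\<lambda>z. c * norm (x - z) + g z) ` Z)" for x
    using below by (rule bdd_belowI2)
  have p_le: "p x \<le> c * norm (x - z) + g z" if "z \<in> Z" for x z
    unfolding p_def by (rule cINF_lower[OF bdd that])
  have "sublinear p" unfolding p_def
  proof (rule sublinear_INF[OF _ bdd])
    fix z z' x y assume z: "z \<in> Z" "z' \<in> Z"
    have "norm ((x - z) + (y - z')) \<le> norm (x - z) + norm (y - z')" by (rule norm_triangle_ineq)
    then have "norm (x + y - (z + z')) \<le> norm (x - z) + norm (y - z')"
      by (simp add: algebra_simps)
    from mult_left_mono[OF this c]
    show "\<exists>k\<in>Z. c * norm (x + y - k) + g k \<le> c * norm (x - z) + g z + (c * norm (y - z') + g z')"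
      by (intro bexI[of _ "z + z'"] subspace_add[OF Z] z) (simp add: add[OF z] distrib_left)
  next
    show "(INF z\<in>Z. c * norm (0 - z) + g z) = 0"
    proof (rule antisym)
      show "(INF z\<in>Z. c * norm (0 - z) + g z) \<le> 0" using p_le[OF Z0, of 0] by (simp add: p_def g0)
      show "0 \<le> (INF z\<in>Z. c * norm (0 - z) + g z)"
        using below[of _ 0] by (intro cINF_greatest) (use Z0 in auto)
    qed
  next
    fix z t x assume z: "z \<in> Z" and t: "(0::real) < t"
    have "norm (t *\<^sub>R x - t *\<^sub>R z) = t * norm (x - z)"
      using t by (simp add: scaleR_diff_right[symmetric])
    then show "\<exists>k\<in>Z. c * norm (t *\<^sub>R x - k) + g k \<le> t * (c * norm (x - z) + g z)"
      by (intro bexI[of _ "t *\<^sub>R z"] subspace_scale[OF Z] z) (simp add: scale[OF z] distrib_left)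
  qed (use Z0 in blast)
  then obtain f where f: "linear f" "\<And>x. f x \<le> p x" by (rule linear_below_sublinear) blast
  have neg: "f (- x) = - f x" for x by (rule linear_neg[OF f(1)])
  have le: "f x \<le> c * norm x" for x
    using f(2)[of x] p_le[OF Z0, of x] by (simp add: g0)
  have leZ: "f x \<le> g x" if "x \<in> Z" for x using f(2)[of x] p_le[OF that, of x] by simp
  show thesis
  proof (rule that[OF f(1)])
    show "\<bar>f x\<bar> \<le> c * norm x" for x using le[of x] le[of "- x"] by (simp add: neg)
    fix x assume x: "x \<in> Z"
    have "f (- x) \<le> g (- x)" by (rule leZ[OF subspace_neg[OF Z x]])
    moreover have "g (- x) = - g x" using scale[OF x, of "- 1"] by simp
    ultimately show "f x = g x" using leZ[OF x] by (simp add: neg)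
  qed
qed

text \<open>A complex-linear functional is determined by its real part \<open>f\<close> as \<open>f x - \<i> f (\<i> x)\<close>, so it
  suffices to extend the real part.\<close>

theorem hahn_banach_extension:
  fixes g :: "'a::complex_normed_vector \<Rightarrow> complex"
  assumes Z: "complex_vector.subspace Z"
    and add: "\<And>x y. x \<in> Z \<Longrightarrow> y \<in> Z \<Longrightarrow> g (x + y) = g x + g y"
    and scale: "\<And>a x. x \<in> Z \<Longrightarrow> g (a *\<^sub>C x) = a * g x"
    and bound: "\<And>x. x \<in> Z \<Longrightarrow> cmod (g x) \<le> c * norm x" and c: "0 \<le> c"
  obtains \<phi> :: "'a \<Rightarrow>\<^sub>C\<^sub>L complex" where "\<And>x. x \<in> Z \<Longrightarrow> \<phi> *\<^sub>V x = g x"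
proof -
  have Zr: "subspace Z"
    using Z by (auto simp: subspace_def complex_vector.subspace_def scaleR_scaleC)
  obtain f where f: "linear f" "\<And>x. x \<in> Z \<Longrightarrow> f x = Re (g x)" "\<And>x. \<bar>f x\<bar> \<le> c * norm x"
  proof (rule real_extension[OF Zr, of "\<lambda>x. Re (g x)" c])
    show "\<bar>Re (g x)\<bar> \<le> c * norm x" if "x \<in> Z" for x
      using bound[OF that] abs_Re_le_cmod[of "g x"] by linarith
  qed (use add scale c in \<open>auto simp: scaleR_scaleC\<close>)
  define h where "h x = Complex (f x) (- f (\<i> *\<^sub>C x))" for x
  have f_scale: "f (a *\<^sub>C x) = Re a * f x + Im a * f (\<i> *\<^sub>C x)" for a x
  proof -
    have "a *\<^sub>C x = Re a *\<^sub>R x + Im a *\<^sub>R (\<i> *\<^sub>C x)"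
      by (simp add: scaleR_scaleC scaleC_scaleC scaleC_add_left[symmetric])
        (metis complex_eq mult.commute)
    then show ?thesis by (simp add: linear_add[OF f(1)] linear_scale[OF f(1)])
  qed
  have h_scale: "h (a *\<^sub>C x) = a * h x" for a x
    unfolding h_def scaleC_scaleC f_scale[of a] f_scale[of "\<i> * a"]
    by (simp add: complex_eq_iff algebra_simps)
  have "bounded_linear h"
  proof (rule bounded_linear_intro[where K = "2 * c"])
    show "h (x + y) = h x + h y" for x y
      by (simp add: h_def scaleC_add_right linear_add[OF f(1)] complex_eq_iff)
    show "h (r *\<^sub>R x) = r *\<^sub>R h x" for r x
      unfolding scaleR_scaleC[of r x] h_scale by (simp add: scaleR_conv_of_real)
    fix x
    have "cmod (h x) \<le> \<bar>f x\<bar> + \<bar>f (\<i> *\<^sub>C x)\<bar>"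
      using cmod_le[of "h x"] by (simp add: h_def)
    also have "\<dots> \<le> c * norm x + c * norm (\<i> *\<^sub>C x)" by (intro add_mono f)
    finally show "cmod (h x) \<le> norm x * (2 * c)" by (simp add: norm_scaleC mult_ac)
  qed
  then have "bounded_clinear h"
    by (rule bounded_clinearI) (simp add: h_scale scaleC_complex_def)
  then have apply_h: "CBlinfun h *\<^sub>V x = h x" for x by (simp add: CBlinfun_inverse)
  show thesis
  proof (rule that[of "CBlinfun h"])
    fix x assume x: "x \<in> Z"
    then have "\<i> *\<^sub>C x \<in> Z" by (rule complex_vector.subspace_scale[OF Z])
    then show "CBlinfun h *\<^sub>V x = g x"
      using x by (simp add: apply_h h_def f(2) scale complex_eq_iff)
  qed
qed

text \<open>The functional to be extended sends \<open>k + a x\<close>, with \<open>k\<close> in \<open>K\<close>, to \<open>a\<close>. It is bounded by the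
  inverse distance of \<open>x\<close> from \<open>K\<close>.\<close>

corollary hahn_banach_separation:
  fixes K :: "'a::complex_normed_vector set"
  assumes K: "complex_vector.subspace K" "closed K" and x: "x \<notin> K"
  obtains \<phi> :: "'a \<Rightarrow>\<^sub>C\<^sub>L complex" where "\<And>k. k \<in> K \<Longrightarrow> \<phi> *\<^sub>V k = 0" and "\<phi> *\<^sub>V x \<noteq> 0"
proof -
  obtain d where d: "0 < d" "\<And>y. y \<in> K \<Longrightarrow> d \<le> dist x y"
    using x K(2) unfolding closed_def open_dist by (metis Compl_iff dist_commute not_le)
  have dist: "cmod a * d \<le> norm w" if w: "w - a *\<^sub>C x \<in> K" for a w
  proof (cases "a = 0")
    case False
    have "(- 1 / a) *\<^sub>C (w - a *\<^sub>C x) \<in> K" by (rule complex_vector.subspace_scale[OF K(1) w])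
    then have "d \<le> dist x ((- 1 / a) *\<^sub>C (w - a *\<^sub>C x))" by (rule d)
    also have "\<dots> = norm ((1 / a) *\<^sub>C w)"
      using False by (simp add: dist_norm complex_vector.scale_right_diff_distrib scaleC_scaleC scaleC_one)
    also have "\<dots> = norm w / cmod a" by (simp add: norm_scaleC norm_divide)
    finally show ?thesis using False by (simp add: field_simps)
  qed simp
  define Z where "Z = {w. \<exists>a. w - a *\<^sub>C x \<in> K}"
  define g where "g w = (THE a. w - a *\<^sub>C x \<in> K)" for w
  have g: "g w = a" if w: "w - a *\<^sub>C x \<in> K" for a w
    unfolding g_def
  proof (rule the_equality[where P = "\<lambda>a. w - a *\<^sub>C x \<in> K", OF w])
    fix b assume "w - b *\<^sub>C x \<in> K"
    then have "(w - b *\<^sub>C x) - (w - a *\<^sub>C x) \<in> K"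
      using w by (rule complex_vector.subspace_diff[OF K(1)])
    then have "0 - (b - a) *\<^sub>C x \<in> K" by (simp add: complex_vector.scale_left_diff_distrib)
    from dist[OF this] show "b = a" using d(1) by (simp add: mult_le_0_iff)
  qed
  have add: "(w + w') - (a + a') *\<^sub>C x \<in> K"
    if "w - a *\<^sub>C x \<in> K" "w' - a' *\<^sub>C x \<in> K" for w w' a a'
    using complex_vector.subspace_add[OF K(1) that] by (simp add: scaleC_add_left algebra_simps)
  have scale: "b *\<^sub>C w - (b * a) *\<^sub>C x \<in> K" if "w - a *\<^sub>C x \<in> K" for w a b
    using complex_vector.subspace_scale[OF K(1) that, of b]
    by (simp add: complex_vector.scale_right_diff_distrib scaleC_scaleC)
  have inK: "k - 0 *\<^sub>C x \<in> K" if "k \<in> K" for k using that by simp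
  have inx: "x - 1 *\<^sub>C x \<in> K"
    using complex_vector.subspace_0[OF K(1)] by (simp add: scaleC_one)
  have mem: "w \<in> Z" if "w - a *\<^sub>C x \<in> K" for a w
    using that unfolding Z_def by blast
  have Z: "complex_vector.subspace Z"
    unfolding complex_vector.subspace_def Z_def
    using add scale inK[OF complex_vector.subspace_0[OF K(1)]] by blast
  obtain \<phi> :: "'a \<Rightarrow>\<^sub>C\<^sub>L complex" where \<phi>: "\<And>w. w \<in> Z \<Longrightarrow> \<phi> *\<^sub>V w = g w"
  proof (rule hahn_banach_extension[OF Z, of g "1 / d"])
    show "g (w + w') = g w + g w'" if "w \<in> Z" "w' \<in> Z" for w w'
      using that g add unfolding Z_def by force
    show "g (a *\<^sub>C w) = a * g w" if "w \<in> Z" for a w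
      using that g scale unfolding Z_def by force
    show "cmod (g w) \<le> 1 / d * norm w" if "w \<in> Z" for w
    proof -
      obtain a where a: "w - a *\<^sub>C x \<in> K" using \<open>w \<in> Z\<close> by (auto simp: Z_def)
      from dist[OF a] g[OF a] d(1) show ?thesis by (simp add: field_simps)
    qed
    show "0 \<le> 1 / d" using d by simp
  qed (rule that, blast)
  show thesis
  proof (rule that[of \<phi>])
    show "\<phi> *\<^sub>V k = 0" if "k \<in> K" for k
      using \<phi>[OF mem[OF inK[OF that]]] g[OF inK[OF that]] by simp
    show "\<phi> *\<^sub>V x \<noteq> 0"
      using \<phi>[OF mem[OF inx]] g[OF inx] by simp
  qed
qed

section \<open>Duality\<close>

lemma dual_op_shift: "dual_op A - z *\<^sub>C id_cblinfun = dual_op (A - z *\<^sub>C id_cblinfun)"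
  for A :: "'a::complex_normed_vector \<Rightarrow>\<^sub>C\<^sub>L 'a"
proof (intro cblinfun_eqI)
  fix \<phi> :: "'a \<Rightarrow>\<^sub>C\<^sub>L complex" and x
  have "linear (cblinfun_apply \<phi>)" by (rule bounded_linear.linear[OF bounded_linear_apply])
  then show "((dual_op A - z *\<^sub>C id_cblinfun) *\<^sub>V \<phi>) *\<^sub>V x
      = (dual_op (A - z *\<^sub>C id_cblinfun) *\<^sub>V \<phi>) *\<^sub>V x"
    by (simp add: minus_cblinfun.rep_eq scaleC_cblinfun.rep_eq id_cblinfun.rep_eq dual_op_apply
        linear_diff cblinfun_apply_scaleC)
qed

lemma dual_op_funpow:
  fixes S :: "'a::complex_normed_vector \<Rightarrow>\<^sub>C\<^sub>L 'a"
  shows "((cblinfun_apply (dual_op S) ^^ k) \<phi>) *\<^sub>V x = \<phi> *\<^sub>V ((cblinfun_apply S ^^ k) x)"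
  by (induction k arbitrary: x) (simp_all add: dual_op_apply funpow_swap1[of "cblinfun_apply S"])

text \<open>By the estimate, \<open>S\<^bsup>p + 1\<^esup> x \<mapsto> \<phi> (S\<^sup>p x)\<close> is a well-defined bounded functional on the range of
  \<open>S\<^bsup>p + 1\<^esup>\<close>. Any extension \<open>\<psi>\<close> of it is mapped by the power \<open>p + 1\<close> of the dual operator to the image
  of \<open>\<phi>\<close> under the power \<open>p\<close>.\<close>

lemma range_dual_op_funpow:
  fixes S :: "'a::complex_normed_vector \<Rightarrow>\<^sub>C\<^sub>L 'a"
  assumes c: "0 < c"
    and bound: "\<And>x. norm ((cblinfun_apply S ^^ p) x) \<le> c * norm ((cblinfun_apply S ^^ (p + 1)) x)"
  shows "range (cblinfun_apply (dual_op S) ^^ p) = range (cblinfun_apply (dual_op S) ^^ (p + 1))"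
proof
  let ?D = "cblinfun_apply (dual_op S)"
  define F where "F = cblinfun_apply S ^^ p"
  define G where "G = cblinfun_apply S ^^ (p + 1)"
  show "range (?D ^^ (p + 1)) \<subseteq> range (?D ^^ p)"
    by (metis funpow_funpow image_subsetI rangeI)
  have "(?D ^^ p) \<phi> \<in> range (?D ^^ (p + 1))" for \<phi>
  proof -
    define g where "g w = \<phi> *\<^sub>V F (inv G w)" for w
    have lin: "linear (cblinfun_apply \<phi>)" by (rule bounded_linear.linear[OF bounded_linear_apply])
    have F_eq: "F x = F y" if "G x = G y" for x y
    proof -
      have "G (x - y) = 0" using that by (simp add: G_def funpow_linear_simps del: funpow.simps)
      then have "norm (F (x - y)) \<le> 0" using bound[of "x - y"] unfolding F_def G_def by simp
      then show ?thesis by (simp add: F_def funpow_linear_simps)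
    qed
    have g: "g (G x) = \<phi> *\<^sub>V F x" for x
      unfolding g_def by (metis F_eq f_inv_into_f rangeI)
    obtain \<psi> :: "'a \<Rightarrow>\<^sub>C\<^sub>L complex" where \<psi>: "\<And>w. w \<in> range G \<Longrightarrow> \<psi> *\<^sub>V w = g w"
    proof (rule hahn_banach_extension[of "range G" g "norm \<phi> * c"])
      show "complex_vector.subspace (range G)" unfolding G_def by (rule subspace_range_funpow)
      show "g (v + w) = g v + g w" if vw: "v \<in> range G" "w \<in> range G" for v w
      proof -
        obtain x y where xy: "v = G x" "w = G y" using vw by blast
        have "v + w = G (x + y)" unfolding xy G_def by (rule funpow_linear_simps[symmetric])
        then show ?thesis unfolding xy g
          by (simp add: g F_def funpow_linear_simps linear_add[OF lin])
      qed
      show "g (a *\<^sub>C w) = a * g w" if w: "w \<in> range G" for a w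
      proof -
        obtain x where x: "w = G x" using w by blast
        have "a *\<^sub>C w = G (a *\<^sub>C x)" unfolding x G_def by (rule funpow_linear_simps[symmetric])
        then show ?thesis unfolding x g
          by (simp add: g F_def funpow_linear_simps cblinfun_apply_scaleC scaleC_complex_def)
      qed
      show "cmod (g w) \<le> norm \<phi> * c * norm w" if w: "w \<in> range G" for w
      proof -
        obtain x where x: "w = G x" using w by blast
        have "cmod (g w) \<le> norm \<phi> * norm (F x)" unfolding x g by (rule norm_cblinfun_bound)
        also have "\<dots> \<le> norm \<phi> * (c * norm (G x))"
          using bound[of x] unfolding F_def G_def by (rule mult_left_mono) simp
        finally show ?thesis by (simp add: x mult.assoc)
      qed
      show "0 \<le> norm \<phi> * c" using c by simp
    qed (rule that, blast)
    have "(?D ^^ p) \<phi> = (?D ^^ (p + 1)) \<psi>"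
    proof (rule cblinfun_eqI)
      fix x
      show "((?D ^^ p) \<phi>) *\<^sub>V x = ((?D ^^ (p + 1)) \<psi>) *\<^sub>V x"
        unfolding dual_op_funpow using \<psi>[of "G x"] g[of x] unfolding F_def G_def by simp
    qed
    then show ?thesis by blast
  qed
  then show "range (?D ^^ p) \<subseteq> range (?D ^^ (p + 1))" by blast
qed

lemma clinear_closure_subspace:
  fixes V :: "'a::complex_normed_vector set"
  assumes V: "complex_vector.subspace V"
  shows "complex_vector.subspace (closure V)"
proof -
  have "a + b \<in> closure V" if ab: "a \<in> closure V" "b \<in> closure V" for a b
  proof -
    obtain f g where "\<And>n. f n \<in> V" "f \<longlonglongrightarrow> a" "\<And>n. g n \<in> V" "g \<longlonglongrightarrow> b"
      using ab unfolding closure_sequential by blast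
    then show ?thesis
      unfolding closure_sequential using complex_vector.subspace_add[OF V] tendsto_add
      by (intro exI[of _ "\<lambda>n. f n + g n"]) blast
  qed
  moreover have "c *\<^sub>C a \<in> closure V" if a: "a \<in> closure V" for c a
  proof -
    obtain f where "\<And>n. f n \<in> V" "f \<longlonglongrightarrow> a" using a unfolding closure_sequential by blast
    then show ?thesis
      unfolding closure_sequential
      using complex_vector.subspace_scale[OF V] bounded_linear.tendsto[OF bounded_linear_scaleC_right]
      by (intro exI[of _ "\<lambda>n. c *\<^sub>C f n"]) blast
  qed
  moreover have "0 \<in> closure V"
    using complex_vector.subspace_0[OF V] closure_subset by blast
  ultimately show ?thesis by (simp add: complex_vector.subspace_def)
qed

text \<open>The dual operator has finite descent by the estimate, hence finite ascent by SVEP: a functional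
  vanishing on the range of \<open>S\<^bsup>p + 1\<^esup>\<close> vanishes on that of \<open>S\<^sup>p\<close>. By Hahn--Banach the two ranges have
  the same closure \<open>K\<close>. The estimate shows that \<open>S\<close> maps \<open>K\<close> onto itself, because preimages of a
  convergent sequence converge. So \<open>S\<^sup>p x\<close>, which lies in \<open>K\<close>, equals \<open>S\<^sup>p v\<close> for some \<open>v\<close> in \<open>K\<close>; then
  \<open>x - v\<close> is in the kernel of \<open>S\<^sup>p\<close> and \<open>v\<close> is in the range of every power of \<open>S\<close>.\<close>

lemma range_sum_of_dual_svep:
  fixes A :: "'a::complex_banach \<Rightarrow>\<^sub>C\<^sub>L 'a" and z :: complex
  defines "S \<equiv> A - z *\<^sub>C id_cblinfun"
  assumes svep: "svep_at (dual_op A) z" and c: "0 < c"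
    and bound: "\<And>x. norm ((cblinfun_apply S ^^ p) x) \<le> c * norm ((cblinfun_apply S ^^ (p + 1)) x)"
  shows "\<exists>n u. (cblinfun_apply S ^^ p) n = 0 \<and> x = n + (cblinfun_apply S ^^ k) u"
proof -
  let ?D = "cblinfun_apply (dual_op S)"
  define F where "F = cblinfun_apply S ^^ p"
  define G where "G = cblinfun_apply S ^^ (p + 1)"
  have SF: "S *\<^sub>V F u = G u" for u by (simp add: F_def G_def)
  have ascent: "(?D ^^ p) \<phi> = 0" if "(?D ^^ (p + 1)) \<phi> = 0" for \<phi>
    using svep_at_ascent_le_descent[OF svep, of p \<phi>] range_dual_op_funpow[OF c bound] that
    unfolding dual_op_shift S_def[symmetric] by blast
  define K where "K = closure (range G)"
  have subK: "complex_vector.subspace K"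
    unfolding K_def G_def by (intro clinear_closure_subspace subspace_range_funpow)
  have F_K: "F u \<in> K" for u
  proof (rule ccontr)
    assume "F u \<notin> K"
    then obtain \<phi> :: "'a \<Rightarrow>\<^sub>C\<^sub>L complex" where \<phi>: "\<And>k. k \<in> K \<Longrightarrow> \<phi> *\<^sub>V k = 0" "\<phi> *\<^sub>V F u \<noteq> 0"
      using hahn_banach_separation[OF subK] unfolding K_def by (metis closed_closure)
    have "(?D ^^ (p + 1)) \<phi> = 0"
    proof (rule cblinfun_eqI)
      fix x
      have "G x \<in> K" unfolding K_def by (rule subsetD[OF closure_subset rangeI])
      then show "((?D ^^ (p + 1)) \<phi>) *\<^sub>V x = 0 *\<^sub>V x"
        unfolding dual_op_funpow using \<phi>(1) by (simp add: G_def zero_cblinfun.rep_eq)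
    qed
    then have "(?D ^^ p) \<phi> = 0" by (rule ascent)
    then show False using dual_op_funpow[of p S \<phi> u] \<phi>(2) by (simp add: F_def zero_cblinfun.rep_eq)
  qed
  have onto: "\<exists>w\<in>K. S *\<^sub>V w = v" if v: "v \<in> K" for v
  proof -
    obtain y where y: "\<And>n. y n \<in> range G" "y \<longlonglongrightarrow> v"
      using v unfolding K_def closure_sequential by blast
    then have "\<forall>n. \<exists>x. y n = G x" by blast
    from choice[OF this] obtain t where t: "\<And>n. y n = G (t n)" by blast
    have le: "norm (F (t m) - F (t n)) \<le> c * norm (y m - y n)" for m n
      using bound[of "t m - t n"] unfolding t
      by (simp add: F_def G_def funpow_linear_simps del: funpow.simps)
    have "Cauchy (\<lambda>n. F (t n))"
    proof (rule CauchyI)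
      fix e :: real assume "0 < e"
      then have "0 < e / c" using c by simp
      from CauchyD[OF LIMSEQ_imp_Cauchy[OF y(2)] this]
      obtain N where N: "\<forall>m\<ge>N. \<forall>n\<ge>N. norm (y m - y n) < e / c" by blast
      have "norm (F (t m) - F (t n)) < e" if "N \<le> m" "N \<le> n" for m n
      proof -
        have "c * norm (y m - y n) < e" using N that c by (simp add: field_simps)
        with le[of m n] show ?thesis by linarith
      qed
      then show "\<exists>N. \<forall>m\<ge>N. \<forall>n\<ge>N. norm (F (t m) - F (t n)) < e" by blast
    qed
    then obtain w where w: "(\<lambda>n. F (t n)) \<longlonglongrightarrow> w"
      using Cauchy_convergent convergent_def by blast
    have "w \<in> K"
      using closed_sequentially[of K "\<lambda>n. F (t n)" w] F_K w unfolding K_def by simp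
    moreover have "S *\<^sub>V w = v"
    proof (rule LIMSEQ_unique[OF _ y(2)])
      show "y \<longlonglongrightarrow> S *\<^sub>V w"
        using bounded_linear.tendsto[OF bounded_linear_apply[of S] w] unfolding SF t[symmetric] .
    qed
    ultimately show ?thesis by blast
  qed
  have onto_pow: "\<exists>w\<in>K. (cblinfun_apply S ^^ k) w = v" if "v \<in> K" for k v
    using that
  proof (induction k arbitrary: v)
    case (Suc k)
    obtain w where "w \<in> K" "S *\<^sub>V w = v" using onto[OF Suc.prems] by blast
    with Suc.IH[of w] show ?case by auto
  qed auto
  obtain v where v: "v \<in> K" "F v = F x" using onto_pow[OF F_K, of p x] unfolding F_def by blast
  obtain u where u: "(cblinfun_apply S ^^ k) u = v" using onto_pow[OF v(1)] by blast
  have "F (x - v) = 0" using v(2) by (simp add: F_def funpow_linear_simps)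
  moreover have "x = (x - v) + (cblinfun_apply S ^^ k) u" by (simp add: u)
  ultimately show ?thesis unfolding F_def by blast
qed

section \<open>The Browder spectrum of a triangular operator\<close>

lemma upper_triangular_shift:
  "upper_triangular_op A C B - z *\<^sub>C id_cblinfun
    = upper_triangular_op (A - z *\<^sub>C id_cblinfun) C (B - z *\<^sub>C id_cblinfun)"
  by (rule cblinfun_eqI)
    (simp add: shift_apply upper_triangular_op.rep_eq case_prod_beta scaleC_prod_def prod_eq_iff)

text \<open>SVEP for \<open>B\<close> settles the lower corner and SVEP for the dual of \<open>A\<close> the upper one; the remaining
  corner then follows from \<open>M\<close> and the one settled.\<close>

lemma fitting_corners:
  fixes A :: "'a::complex_banach \<Rightarrow>\<^sub>C\<^sub>L 'a" and B :: "'b::complex_banach \<Rightarrow>\<^sub>C\<^sub>L 'b"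
    and C :: "'b \<Rightarrow>\<^sub>C\<^sub>L 'a" and z :: complex
  defines "R \<equiv> A - z *\<^sub>C id_cblinfun" and "S \<equiv> B - z *\<^sub>C id_cblinfun"
  assumes M: "fitting (upper_triangular_op R C S) p"
    and svep: "svep_at (dual_op A) z \<or> svep_at B z"
  shows "fitting R p \<and> fitting S p"
  using svep
proof
  assume B: "svep_at B z"
  have descent: "range (cblinfun_apply S ^^ p) = range (cblinfun_apply S ^^ (p + 1))"
    by (rule range_lower_corner[OF M])
  have "fitting S p"
    using svep_at_ascent_le_descent[OF B] descent unfolding S_def[symmetric]
    by (intro fitting_lower_corner_of_ascent[OF M]) blast
  with fitting_upper_corner[OF M] show ?thesis by blast
next
  assume A: "svep_at (dual_op A) z"
  obtain c where c: "0 < c" "\<And>e. norm ((cblinfun_apply (upper_triangular_op R C S) ^^ p) e)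
      \<le> c * norm ((cblinfun_apply (upper_triangular_op R C S) ^^ (p + 1)) e)"
    using fitting_bounded_below[OF M] by blast
  have bound: "norm ((cblinfun_apply R ^^ p) x) \<le> c * norm ((cblinfun_apply R ^^ (p + 1)) x)" for x
    using c(2)[of "(x, 0)"] unfolding upper_triangular_funpow by (simp add: norm_Pair)
  have "fitting R p"
    using range_sum_of_dual_svep[OF A c(1)] bound unfolding R_def[symmetric]
    by (intro fittingI[OF kernel_upper_corner(1)[OF M]
          kernel_upper_corner(2)[OF M]]) blast+
  with fitting_lower_corner[OF M] show ?thesis by blast
qed

theorem theorem3p2:
  fixes A :: "'a::complex_banach \<Rightarrow>\<^sub>C\<^sub>L 'a"
    and B :: "'b::complex_banach \<Rightarrow>\<^sub>C\<^sub>L 'b"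
    and C :: "'b \<Rightarrow>\<^sub>C\<^sub>L 'a"
  assumes "cdim (UNIV :: 'a set) = \<infinity>"
    and "cdim (UNIV :: 'b set) = \<infinity>"
  shows "browder_spectrum (upper_triangular_op A C B)
           \<union> (svep_failure (dual_op A) \<inter> svep_failure B)
         = browder_spectrum A \<union> browder_spectrum B"
proof -
  have "browder (upper_triangular_op A C B - z *\<^sub>C id_cblinfun)
        \<and> (svep_at (dual_op A) z \<or> svep_at B z)
      \<longleftrightarrow> browder (A - z *\<^sub>C id_cblinfun) \<and> browder (B - z *\<^sub>C id_cblinfun)"
    (is "?M \<and> ?svep \<longleftrightarrow> ?A \<and> ?B") for z
  proof
    assume "?M \<and> ?svep"
    then show "?A \<and> ?B"
      unfolding upper_triangular_shift browder_iff_fitting using fitting_corners by blast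
  next
    assume "?A \<and> ?B"
    then obtain p q where "fitting (A - z *\<^sub>C id_cblinfun) p" and q: "fitting (B - z *\<^sub>C id_cblinfun) q"
      unfolding browder_iff_fitting by blast
    then have "fitting (A - z *\<^sub>C id_cblinfun) (max p q)" "fitting (B - z *\<^sub>C id_cblinfun) (max p q)"
      by (auto intro: fitting_mono)
    then have ?M
      unfolding upper_triangular_shift browder_iff_fitting using fitting_upper_triangular by blast
    moreover have "svep_at B z" using q by (rule svep_at_of_fitting)
    ultimately show "?M \<and> ?svep" by blast
  qed
  then show ?thesis by (auto simp: browder_spectrum_def svep_failure_def)
qed

end
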